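(* Let $R$ be a Dedekind domain, and let $M$ be a flat (i.e. torsion-free) $R$-module. Let $0\neq f\in M$. Then $f\in c(f)M$ if and only if the following two conditions hold: (1) $L_f\cap\operatorname{Spec}R$ is finite, and (2) there is some $n\in\mathbb N$ such that for all $\mathfrak p\in\operatorname{Spec}R$, $f\notin\mathfrak p^nM$. Hence $M$ is an Ohm-Rush $R$-module if and only if (1) and (2) hold for every nonzero $f\in M$.
   Context: For a ring $R$, an $R$-module $M$ and $f\in M$, put $L_f:=\{I\subseteq R \text{ ideal} \mid f\in IM\}$; the (Ohm-Rush) content of $f$ is the ideal $c(f):=\bigcap_{I\in L_f} I$ of $R$. The $R$-module $M$ is Ohm-Rush if $f\in c(f)M$ for all $f\in M$. *)

theory Defs
  imports
    "HOL-Algebra.Ideal_Product"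
    "HOL-Algebra.Ring_Divisibility"
    "HOL-Algebra.Polynomials"
    "HOL-Algebra.Module"
    "HOL-Algebra.Free_Abelian_Groups"
begin

section \<open>Dedekind domains\<close>

text \<open>The fraction \<open>a / b\<close>, as the class of all pairs (numerator, denominator)
  equivalent to \<open>(a, b)\<close>. Sums and products of classes do not depend on the chosen
  representatives, so the unions in \<open>fraction_field\<close> are unions of a single class.\<close>

definition fraction :: "('a, 'm) ring_scheme \<Rightarrow> 'a \<Rightarrow> 'a \<Rightarrow> ('a \<times> 'a) set" where
  "fraction R a b =
     {(c, d). c \<in> carrier R \<and> d \<in> carrier R - {\<zero>\<^bsub>R\<^esub>} \<and> a \<otimes>\<^bsub>R\<^esub> d = c \<otimes>\<^bsub>R\<^esub> b}"

definition fraction_field :: "('a, 'm) ring_scheme \<Rightarrow> ('a \<times> 'a) set ring" where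
  "fraction_field R =
     \<lparr> carrier = {fraction R a b | a b. a \<in> carrier R \<and> b \<in> carrier R - {\<zero>\<^bsub>R\<^esub>}},
       monoid.mult = (\<lambda>A B. \<Union> {fraction R (a \<otimes>\<^bsub>R\<^esub> c) (b \<otimes>\<^bsub>R\<^esub> d) | a b c d. (a, b) \<in> A \<and> (c, d) \<in> B}),
       monoid.one = fraction R \<one>\<^bsub>R\<^esub> \<one>\<^bsub>R\<^esub>,
       ring.zero = fraction R \<zero>\<^bsub>R\<^esub> \<one>\<^bsub>R\<^esub>,
       ring.add = (\<lambda>A B. \<Union> {fraction R (a \<otimes>\<^bsub>R\<^esub> d \<oplus>\<^bsub>R\<^esub> c \<otimes>\<^bsub>R\<^esub> b) (b \<otimes>\<^bsub>R\<^esub> d) | a b c d.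
                (a, b) \<in> A \<and> (c, d) \<in> B}) \<rparr>"

definition frac_embed :: "('a, 'm) ring_scheme \<Rightarrow> 'a \<Rightarrow> ('a \<times> 'a) set" where
  "frac_embed R a = fraction R a \<one>\<^bsub>R\<^esub>"

definition integral_over :: "('k, 'm) ring_scheme \<Rightarrow> 'k set \<Rightarrow> 'k \<Rightarrow> bool" where
  "integral_over K S x \<longleftrightarrow>
     (\<exists>p. p \<in> carrier (S[X]\<^bsub>K\<^esub>) \<and> p \<noteq> [] \<and> lead_coeff p = \<one>\<^bsub>K\<^esub> \<and> ring.eval K p x = \<zero>\<^bsub>K\<^esub>)"

definition integrally_closed :: "('a, 'm) ring_scheme \<Rightarrow> bool" where
  "integrally_closed R \<longleftrightarrow>
     (\<forall>x \<in> carrier (fraction_field R).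
        integral_over (fraction_field R) (frac_embed R ` carrier R) x \<longrightarrow>
        x \<in> frac_embed R ` carrier R)"

text \<open>Krull dimension at most one rather than exactly one: fields are included.\<close>

locale dedekind_domain = noetherian_domain R for R (structure) +
  assumes integrally_closed: "integrally_closed R"
    and nonzero_prime_maximal: "\<lbrakk>primeideal P R; P \<noteq> {\<zero>}\<rbrakk> \<Longrightarrow> maximalideal P R"

section \<open>Flat and torsion-free modules\<close>

text \<open>The tensor product \<open>M \<otimes>\<^sub>R N\<close> as an abelian group: the free abelian group on
  \<open>M \<times> N\<close> modulo the subgroup generated by the bilinearity relations. The basis
  element of the pair \<open>(x, y)\<close> is \<open>frag_of (x, y)\<close>.\<close>

definition tensor_relations ::
  "('a, 'm) ring_scheme \<Rightarrow> ('a, 'b, 'n) module_scheme \<Rightarrow> ('a, 'c, 'k) module_scheme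
     \<Rightarrow> ('b \<times> 'c \<Rightarrow>\<^sub>0 int) set" where
  "tensor_relations R M N =
     {frag_of (x \<oplus>\<^bsub>M\<^esub> x', y) - frag_of (x, y) - frag_of (x', y) | x x' y.
        x \<in> carrier M \<and> x' \<in> carrier M \<and> y \<in> carrier N} \<union>
     {frag_of (x, y \<oplus>\<^bsub>N\<^esub> y') - frag_of (x, y) - frag_of (x, y') | x y y'.
        x \<in> carrier M \<and> y \<in> carrier N \<and> y' \<in> carrier N} \<union>
     {frag_of (r \<odot>\<^bsub>M\<^esub> x, y) - frag_of (x, r \<odot>\<^bsub>N\<^esub> y) | r x y.
        r \<in> carrier R \<and> x \<in> carrier M \<and> y \<in> carrier N}"

definition tensor_null ::
  "('a, 'm) ring_scheme \<Rightarrow> ('a, 'b, 'n) module_scheme \<Rightarrow> ('a, 'c, 'k) module_scheme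
     \<Rightarrow> ('b \<times> 'c \<Rightarrow>\<^sub>0 int) set" where
  "tensor_null R M N =
     generate (free_Abelian_group (carrier M \<times> carrier N)) (tensor_relations R M N)"

definition tensor ::
  "('a, 'm) ring_scheme \<Rightarrow> ('a, 'b, 'n) module_scheme \<Rightarrow> ('a, 'c, 'k) module_scheme
     \<Rightarrow> ('b \<times> 'c \<Rightarrow>\<^sub>0 int) set monoid" where
  "tensor R M N = free_Abelian_group (carrier M \<times> carrier N) Mod tensor_null R M N"

text \<open>The map \<open>id \<otimes> h\<close> from \<open>M \<otimes>\<^sub>R N'\<close> to \<open>M \<otimes>\<^sub>R N\<close> induced by \<open>h : N' \<rightarrow> N\<close>;
  only the target \<open>N\<close> enters the formula.\<close>

definition tensor_map ::
  "('a, 'm) ring_scheme \<Rightarrow> ('a, 'b, 'n) module_scheme \<Rightarrow> ('a, 'c, 'k) module_scheme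
     \<Rightarrow> ('d \<Rightarrow> 'c) \<Rightarrow> ('b \<times> 'd \<Rightarrow>\<^sub>0 int) set \<Rightarrow> ('b \<times> 'c \<Rightarrow>\<^sub>0 int) set" where
  "tensor_map R M N h T =
     the_elem
       ((\<lambda>z. tensor_null R M N #>\<^bsub>free_Abelian_group (carrier M \<times> carrier N)\<^esub>
               frag_extend (\<lambda>(x, y). frag_of (x, h y)) z) ` T)"

definition linear_maps ::
  "('a, 'm) ring_scheme \<Rightarrow> ('a, 'd, 'n) module_scheme \<Rightarrow> ('a, 'c, 'k) module_scheme
     \<Rightarrow> ('d \<Rightarrow> 'c) set" where
  "linear_maps R N' N =
     {h \<in> hom (add_monoid N') (add_monoid N).
        \<forall>r \<in> carrier R. \<forall>x \<in> carrier N'. h (r \<odot>\<^bsub>N'\<^esub> x) = r \<odot>\<^bsub>N\<^esub> h x}"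

text \<open>Tensoring with \<open>M\<close> preserves injections. HOL cannot quantify over modules of all
  types here, so the test modules live on the element type of \<open>R\<close>. This loses nothing:
  the inclusions of ideals into \<open>R\<close> are among the test maps, and these already
  detect flatness.\<close>

definition flat_module :: "('a, 'm) ring_scheme \<Rightarrow> ('a, 'b, 'n) module_scheme \<Rightarrow> bool" where
  "flat_module R M \<longleftrightarrow>
     (\<forall>(N' :: ('a, 'a) module) (N :: ('a, 'a) module) h.
        module R N' \<and> module R N \<and> h \<in> linear_maps R N' N \<and> inj_on h (carrier N') \<longrightarrow>
        inj_on (tensor_map R M N h) (carrier (tensor R M N')))"

text \<open>Over a Dedekind domain, flat and torsion-free are the same. The theorem assumes their
  disjunction, so that it applies to either description of the modules without
  presupposing this equivalence.\<close>

definition torsion_free_module ::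
  "('a, 'm) ring_scheme \<Rightarrow> ('a, 'b, 'n) module_scheme \<Rightarrow> bool" where
  "torsion_free_module R M \<longleftrightarrow>
     (\<forall>r \<in> carrier R. \<forall>x \<in> carrier M. r \<odot>\<^bsub>M\<^esub> x = \<zero>\<^bsub>M\<^esub> \<longrightarrow> r = \<zero>\<^bsub>R\<^esub> \<or> x = \<zero>\<^bsub>M\<^esub>)"

section \<open>Ohm-Rush content\<close>

text \<open>The submodule \<open>I M\<close>: all finite sums of products \<open>r \<odot> x\<close> with \<open>r \<in> I\<close>, \<open>x \<in> M\<close>.
  For an ideal \<open>I\<close> the additive subgroup generated by these products is already a
  submodule.\<close>

definition ideal_mult :: "('a, 'b, 'n) module_scheme \<Rightarrow> 'a set \<Rightarrow> 'b set" where
  "ideal_mult M I = generate (add_monoid M) {r \<odot>\<^bsub>M\<^esub> x | r x. r \<in> I \<and> x \<in> carrier M}"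

definition content_ideals ::
  "('a, 'm) ring_scheme \<Rightarrow> ('a, 'b, 'n) module_scheme \<Rightarrow> 'b \<Rightarrow> 'a set set" where
  "content_ideals R M f = {I. ideal I R \<and> f \<in> ideal_mult M I}"

definition ohm_rush_content ::
  "('a, 'm) ring_scheme \<Rightarrow> ('a, 'b, 'n) module_scheme \<Rightarrow> 'b \<Rightarrow> 'a set" where
  "ohm_rush_content R M f = \<Inter> (content_ideals R M f)"

definition ohm_rush :: "('a, 'm) ring_scheme \<Rightarrow> ('a, 'b, 'n) module_scheme \<Rightarrow> bool" where
  "ohm_rush R M \<longleftrightarrow> (\<forall>f \<in> carrier M. f \<in> ideal_mult M (ohm_rush_content R M f))"

definition Spec :: "('a, 'm) ring_scheme \<Rightarrow> 'a set set" where
  "Spec R = {P. primeideal P R}"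

text \<open>Powers of ideals are taken in \<^term>\<open>ideals_set R\<close>, the semiring of ideals; thus
  \<open>P [^] 0\<close> is \<^term>\<open>carrier R\<close>.\<close>

definition ideal_power :: "('a, 'm) ring_scheme \<Rightarrow> 'a set \<Rightarrow> nat \<Rightarrow> 'a set" where
  "ideal_power R P n = P [^]\<^bsub>ideals_set R\<^esub> n"

end

theory Submission
  imports Defs
begin

text \<open>The key is that a nonzero prime \<open>P\<close> of a Dedekind domain is invertible. Choose \<open>a \<in> P\<close>
  nonzero; a colon ideal \<open>(a) : b\<close> maximal among those contained in \<open>P\<close> is prime, hence equal to \<open>P\<close>,
  and the resulting fraction \<open>b / a\<close> maps \<open>P\<close> into \<open>R\<close> but, by integral closedness, not into \<open>P\<close>.
  Thus every ideal \<open>J \<subseteq> P\<close> is \<open>P \<cdot> J'\<close> with \<open>J'\<close> strictly larger if \<open>J\<close> is nonzero, and Noetherian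
  induction shows that a nonzero ideal lies in finitely many primes, not in all powers of one of
  them, and is determined by the prime powers containing it.

  If \<open>f \<in> c(f)M\<close>, then \<open>f \<in> IM\<close> forces \<open>c(f) \<subseteq> I\<close>, so (1) and (2) follow from these facts for
  \<open>c(f) \<noteq> 0\<close>. Conversely, let \<open>I\<close> be the intersection of the largest prime powers \<open>Q\<close> with \<open>f \<in> QM\<close>.
  These are pairwise comaximal, so \<open>f \<in> IM\<close>, and \<open>I\<close> is contained in every ideal of \<open>L\<^sub>f\<close>.\<close>

section \<open>The field of fractions\<close>

context domain
begin

text \<open>By symmetry one inclusion suffices. If \<open>(x, y)\<close> represents
  \<open>a / b\<close>, then \<open>c \<otimes> y\<close> and \<open>x \<otimes> d\<close> agree
  after multiplication by \<open>b\<close>, which cancels in a domain.\<close>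

lemma fraction_eq_iff:
  assumes "a \<in> carrier R" "b \<in> carrier R - {\<zero>}" "c \<in> carrier R" "d \<in> carrier R - {\<zero>}"
  shows "fraction R a b = fraction R c d \<longleftrightarrow> a \<otimes> d = c \<otimes> b"
proof
  assume "fraction R a b = fraction R c d"
  moreover have "(a, b) \<in> fraction R a b"
    using assms by (simp add: fraction_def)
  ultimately have "(a, b) \<in> fraction R c d" by simp
  then show "a \<otimes> d = c \<otimes> b" by (simp add: fraction_def)
next
  have *: "fraction R a b \<subseteq> fraction R c d"
    if "a \<in> carrier R" "b \<in> carrier R - {\<zero>}" "c \<in> carrier R" "d \<in> carrier R - {\<zero>}"
      "a \<otimes> d = c \<otimes> b" for a b c d
  proof
    fix z assume "z \<in> fraction R a b"
    then obtain x y where z: "z = (x, y)" "x \<in> carrier R" "y \<in> carrier R - {\<zero>}" "a \<otimes> y = x \<otimes> b"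
      by (auto simp: fraction_def)
    have "b \<otimes> (c \<otimes> y) = (c \<otimes> b) \<otimes> y" using that(1-4) z(2,3) by (simp add: m_ac)
    also have "\<dots> = (a \<otimes> d) \<otimes> y" using that(5) by simp
    also have "\<dots> = d \<otimes> (a \<otimes> y)" using that(1-4) z(2,3) by (simp add: m_ac)
    also have "\<dots> = d \<otimes> (x \<otimes> b)" using z(4) by simp
    also have "\<dots> = b \<otimes> (x \<otimes> d)" using that(1-4) z(2,3) by (simp add: m_ac)
    finally have "c \<otimes> y = x \<otimes> d"
      using that z m_lcancel[of b "c \<otimes> y" "x \<otimes> d"] by simp
    then show "z \<in> fraction R c d" using z by (simp add: fraction_def)
  qed
  assume "a \<otimes> d = c \<otimes> b"
  then show "fraction R a b = fraction R c d"
    using *[of a b c d] *[of c d a b] assms by auto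
qed

lemma mem_fraction:
  assumes "(x, y) \<in> fraction R a b" "a \<in> carrier R" "b \<in> carrier R - {\<zero>}"
  shows "x \<in> carrier R" "y \<in> carrier R - {\<zero>}" "x \<otimes> b = a \<otimes> y"
  using assms by (auto simp: fraction_def)

lemma fraction_self: "a \<in> carrier R \<Longrightarrow> b \<in> carrier R - {\<zero>} \<Longrightarrow> (a, b) \<in> fraction R a b"
  by (simp add: fraction_def)

lemma carrier_fraction_field:
  "carrier (fraction_field R) = {fraction R a b | a b. a \<in> carrier R \<and> b \<in> carrier R - {\<zero>}}"
  by (simp add: fraction_field_def)

lemma fraction_closed [simp]:
  "a \<in> carrier R \<Longrightarrow> b \<in> carrier R \<Longrightarrow> b \<noteq> \<zero> \<Longrightarrow> fraction R a b \<in> carrier (fraction_field R)"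
  by (auto simp: carrier_fraction_field)

lemma fraction_cases:
  assumes "x \<in> carrier (fraction_field R)"
  obtains a b where "x = fraction R a b" "a \<in> carrier R" "b \<in> carrier R" "b \<noteq> \<zero>"
  using assms by (auto simp: carrier_fraction_field)

lemma one_fraction_field: "\<one>\<^bsub>fraction_field R\<^esub> = fraction R \<one> \<one>"
  by (simp add: fraction_field_def)

lemma zero_fraction_field: "\<zero>\<^bsub>fraction_field R\<^esub> = fraction R \<zero> \<one>"
  by (simp add: fraction_field_def)

text \<open>All representatives of the factors give the same product class, so the union in the
  definition runs over a singleton; \<open>(a, b)\<close> and \<open>(c, d)\<close> show that the
  family is nonempty.\<close>

lemma fraction_mult:
  assumes "a \<in> carrier R" "b \<in> carrier R" "b \<noteq> \<zero>" "c \<in> carrier R" "d \<in> carrier R" "d \<noteq> \<zero>"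
  shows "fraction R a b \<otimes>\<^bsub>fraction_field R\<^esub> fraction R c d = fraction R (a \<otimes> c) (b \<otimes> d)"
proof -
  have "fraction R (x \<otimes> z) (y \<otimes> w) = fraction R (a \<otimes> c) (b \<otimes> d)"
    if "(x, y) \<in> fraction R a b" "(z, w) \<in> fraction R c d" for x y z w
  proof -
    note m = mem_fraction[OF that(1)] mem_fraction[OF that(2)]
    have "(x \<otimes> z) \<otimes> (b \<otimes> d) = (x \<otimes> b) \<otimes> (z \<otimes> d)" using m(1,2,4,5) assms by (simp add: m_ac)
    also have "\<dots> = (a \<otimes> y) \<otimes> (c \<otimes> w)" using m(3,6) assms by simp
    also have "\<dots> = (a \<otimes> c) \<otimes> (y \<otimes> w)" using m(1,2,4,5) assms by (simp add: m_ac)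
    finally show ?thesis using m(1,2,4,5) assms by (subst fraction_eq_iff) (auto simp: integral_iff)
  qed
  then have "{fraction R (x \<otimes> z) (y \<otimes> w) | x y z w.
      (x, y) \<in> fraction R a b \<and> (z, w) \<in> fraction R c d} = {fraction R (a \<otimes> c) (b \<otimes> d)}"
    using fraction_self[of a b] fraction_self[of c d] assms by blast
  then show ?thesis by (simp add: fraction_field_def)
qed

lemma fraction_add:
  assumes "a \<in> carrier R" "b \<in> carrier R" "b \<noteq> \<zero>" "c \<in> carrier R" "d \<in> carrier R" "d \<noteq> \<zero>"
  shows "fraction R a b \<oplus>\<^bsub>fraction_field R\<^esub> fraction R c d
    = fraction R (a \<otimes> d \<oplus> c \<otimes> b) (b \<otimes> d)"
proof -
  have "fraction R (x \<otimes> w \<oplus> z \<otimes> y) (y \<otimes> w) = fraction R (a \<otimes> d \<oplus> c \<otimes> b) (b \<otimes> d)"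
    if "(x, y) \<in> fraction R a b" "(z, w) \<in> fraction R c d" for x y z w
  proof -
    note m = mem_fraction[OF that(1)] mem_fraction[OF that(2)]
    have "(x \<otimes> w \<oplus> z \<otimes> y) \<otimes> (b \<otimes> d)
        = (x \<otimes> b) \<otimes> (w \<otimes> d) \<oplus> (z \<otimes> d) \<otimes> (y \<otimes> b)"
      using m(1,2,4,5) assms by (simp add: l_distr r_distr m_ac)
    also have "\<dots> = (a \<otimes> y) \<otimes> (w \<otimes> d) \<oplus> (c \<otimes> w) \<otimes> (y \<otimes> b)" using m(3,6) assms by simp
    also have "\<dots> = (a \<otimes> d \<oplus> c \<otimes> b) \<otimes> (y \<otimes> w)"
      using m(1,2,4,5) assms by (simp add: l_distr r_distr m_ac)
    finally show ?thesis using m(1,2,4,5) assms by (subst fraction_eq_iff) (auto simp: integral_iff)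
  qed
  then have "{fraction R (x \<otimes> w \<oplus> z \<otimes> y) (y \<otimes> w) | x y z w.
      (x, y) \<in> fraction R a b \<and> (z, w) \<in> fraction R c d}
      = {fraction R (a \<otimes> d \<oplus> c \<otimes> b) (b \<otimes> d)}"
    using fraction_self[of a b] fraction_self[of c d] assms by blast
  then show ?thesis by (simp add: fraction_field_def)
qed

lemma fraction_cancel:
  assumes "a \<in> carrier R" "b \<in> carrier R" "b \<noteq> \<zero>" "c \<in> carrier R" "c \<noteq> \<zero>"
  shows "fraction R (c \<otimes> a) (c \<otimes> b) = fraction R a b"
  using assms by (subst fraction_eq_iff) (auto simp: integral_iff m_ac)

lemma fraction_add_same:
  assumes "a \<in> carrier R" "b \<in> carrier R" "d \<in> carrier R" "d \<noteq> \<zero>"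
  shows "fraction R a d \<oplus>\<^bsub>fraction_field R\<^esub> fraction R b d = fraction R (a \<oplus> b) d"
proof -
  have "a \<otimes> d \<oplus> b \<otimes> d = d \<otimes> (a \<oplus> b)"
    using assms by (simp add: r_distr m_comm)
  then show ?thesis using assms by (simp add: fraction_add fraction_cancel)
qed

text \<open>Makes the facts on \<open>ring.eval\<close> available, through which
  \<open>integral_over\<close> is defined.\<close>

lemma ring_fraction_field: "ring (fraction_field R)"
proof (rule ringI)
  show "abelian_group (fraction_field R)"
  proof (rule abelian_groupI)
    fix x assume "x \<in> carrier (fraction_field R)"
    then obtain a b where x: "x = fraction R a b" "a \<in> carrier R" "b \<in> carrier R" "b \<noteq> \<zero>"
      by (rule fraction_cases)
    show "\<zero>\<^bsub>fraction_field R\<^esub> \<oplus>\<^bsub>fraction_field R\<^esub> x = x"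
      using x by (simp add: zero_fraction_field fraction_add)
    have "fraction R (\<ominus> a) b \<oplus>\<^bsub>fraction_field R\<^esub> x = \<zero>\<^bsub>fraction_field R\<^esub>"
      using x by (simp add: zero_fraction_field fraction_add_same l_neg fraction_eq_iff)
    then show "\<exists>y\<in>carrier (fraction_field R). y \<oplus>\<^bsub>fraction_field R\<^esub> x = \<zero>\<^bsub>fraction_field R\<^esub>"
      using x by (intro bexI[of _ "fraction R (\<ominus> a) b"]) auto
    fix y assume "y \<in> carrier (fraction_field R)"
    then obtain c d where y: "y = fraction R c d" "c \<in> carrier R" "d \<in> carrier R" "d \<noteq> \<zero>"
      by (rule fraction_cases)
    show "x \<oplus>\<^bsub>fraction_field R\<^esub> y \<in> carrier (fraction_field R)"
      using x y by (simp add: fraction_add integral_iff)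
    show "x \<oplus>\<^bsub>fraction_field R\<^esub> y = y \<oplus>\<^bsub>fraction_field R\<^esub> x"
      using x y by (simp add: fraction_add a_comm m_comm)
    fix z assume "z \<in> carrier (fraction_field R)"
    then obtain e f where z: "z = fraction R e f" "e \<in> carrier R" "f \<in> carrier R" "f \<noteq> \<zero>"
      by (rule fraction_cases)
    show "x \<oplus>\<^bsub>fraction_field R\<^esub> y \<oplus>\<^bsub>fraction_field R\<^esub> z
        = x \<oplus>\<^bsub>fraction_field R\<^esub> (y \<oplus>\<^bsub>fraction_field R\<^esub> z)"
      using x y z by (simp add: fraction_add integral_iff l_distr r_distr a_ac m_ac)
  qed (simp add: zero_fraction_field)
  show "monoid (fraction_field R)"
  proof (rule monoidI)
    fix x assume "x \<in> carrier (fraction_field R)"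
    then obtain a b where x: "x = fraction R a b" "a \<in> carrier R" "b \<in> carrier R" "b \<noteq> \<zero>"
      by (rule fraction_cases)
    show "\<one>\<^bsub>fraction_field R\<^esub> \<otimes>\<^bsub>fraction_field R\<^esub> x = x"
      and "x \<otimes>\<^bsub>fraction_field R\<^esub> \<one>\<^bsub>fraction_field R\<^esub> = x"
      using x by (simp_all add: one_fraction_field fraction_mult)
    fix y assume "y \<in> carrier (fraction_field R)"
    then obtain c d where y: "y = fraction R c d" "c \<in> carrier R" "d \<in> carrier R" "d \<noteq> \<zero>"
      by (rule fraction_cases)
    show "x \<otimes>\<^bsub>fraction_field R\<^esub> y \<in> carrier (fraction_field R)"
      using x y by (simp add: fraction_mult integral_iff)
    fix z assume "z \<in> carrier (fraction_field R)"
    then obtain e f where z: "z = fraction R e f" "e \<in> carrier R" "f \<in> carrier R" "f \<noteq> \<zero>"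
      by (rule fraction_cases)
    show "x \<otimes>\<^bsub>fraction_field R\<^esub> y \<otimes>\<^bsub>fraction_field R\<^esub> z
        = x \<otimes>\<^bsub>fraction_field R\<^esub> (y \<otimes>\<^bsub>fraction_field R\<^esub> z)"
      using x y z by (simp add: fraction_mult integral_iff m_ac)
  qed (simp add: one_fraction_field)
next
  fix x y z
  assume "x \<in> carrier (fraction_field R)" "y \<in> carrier (fraction_field R)"
    "z \<in> carrier (fraction_field R)"
  then obtain a b c d e f where
    x: "x = fraction R a b" "a \<in> carrier R" "b \<in> carrier R" "b \<noteq> \<zero>" and
    y: "y = fraction R c d" "c \<in> carrier R" "d \<in> carrier R" "d \<noteq> \<zero>" and
    z: "z = fraction R e f" "e \<in> carrier R" "f \<in> carrier R" "f \<noteq> \<zero>"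
    by (metis fraction_cases)
  show "(x \<oplus>\<^bsub>fraction_field R\<^esub> y) \<otimes>\<^bsub>fraction_field R\<^esub> z
      = x \<otimes>\<^bsub>fraction_field R\<^esub> z \<oplus>\<^bsub>fraction_field R\<^esub> y \<otimes>\<^bsub>fraction_field R\<^esub> z"
    using x y z
    by (simp add: fraction_add fraction_mult integral_iff fraction_eq_iff l_distr r_distr m_ac)
  show "z \<otimes>\<^bsub>fraction_field R\<^esub> (x \<oplus>\<^bsub>fraction_field R\<^esub> y)
      = z \<otimes>\<^bsub>fraction_field R\<^esub> x \<oplus>\<^bsub>fraction_field R\<^esub> z \<otimes>\<^bsub>fraction_field R\<^esub> y"
    using x y z
    by (simp add: fraction_add fraction_mult integral_iff fraction_eq_iff l_distr r_distr m_ac)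
qed

lemma fraction_pow:
  assumes "a \<in> carrier R" "b \<in> carrier R" "b \<noteq> \<zero>"
  shows "fraction R a b [^]\<^bsub>fraction_field R\<^esub> (n::nat) = fraction R (a [^] n) (b [^] n)"
proof -
  interpret K: ring "fraction_field R" by (rule ring_fraction_field)
  have "b [^] k \<noteq> \<zero>" for k :: nat
    by (induction k) (use assms in \<open>auto simp: integral_iff\<close>)
  then show ?thesis
    by (induction n) (use assms in \<open>simp_all add: one_fraction_field fraction_mult\<close>)
qed

end

section \<open>Integral closedness\<close>

text \<open>The ideal of values at \<open>(b, a)\<close> of the binary forms of degree \<open>n - 1\<close> (zero for \<open>n = 0\<close>).\<close>

primrec binary_forms :: "('a, 'm) ring_scheme \<Rightarrow> 'a \<Rightarrow> 'a \<Rightarrow> nat \<Rightarrow> 'a set" where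
  "binary_forms R a b 0 = {\<zero>\<^bsub>R\<^esub>}"
| "binary_forms R a b (Suc n) =
     {r \<otimes>\<^bsub>R\<^esub> b [^]\<^bsub>R\<^esub> n \<oplus>\<^bsub>R\<^esub> a \<otimes>\<^bsub>R\<^esub> h | r h. r \<in> carrier R \<and> h \<in> binary_forms R a b n}"

lemma (in cring) binary_forms_subset:
  assumes "a \<in> carrier R" "b \<in> carrier R"
  shows "binary_forms R a b n \<subseteq> carrier R"
  by (induction n) (use assms in auto)

text \<open>Products of a multiple of \<open>a\<close> with elements of \<open>I\<close> have the
  form \<open>a \<otimes> i\<close>, and sums of these combine by distributivity. Membership thus
  takes one product instead of a finite sum.\<close>

lemma (in cring) PIdl_prod:
  assumes "a \<in> carrier R" "ideal I R"
  shows "(PIdl a) \<cdot> I = {a \<otimes> i | i. i \<in> I}"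
proof
  interpret I: ideal I R by fact
  show "(PIdl a) \<cdot> I \<subseteq> {a \<otimes> i | i. i \<in> I}"
  proof
    fix x assume "x \<in> (PIdl a) \<cdot> I"
    then show "x \<in> {a \<otimes> i | i. i \<in> I}"
    proof (induction rule: ideal_prod.induct)
      case (prod x i)
      then obtain r where r: "r \<in> carrier R" "x = r \<otimes> a" by (auto simp: cgenideal_def)
      then have "x \<otimes> i = a \<otimes> (r \<otimes> i)" "r \<otimes> i \<in> I"
        using prod assms(1) I.Icarr I.I_l_closed by (auto simp: m_ac)
      then show ?case by blast
    next
      case (sum x y)
      then obtain i k where "x = a \<otimes> i" "i \<in> I" "y = a \<otimes> k" "k \<in> I" by blast
      then have "x \<oplus> y = a \<otimes> (i \<oplus> k)" "i \<oplus> k \<in> I"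
        using assms(1) I.Icarr by (auto simp: r_distr)
      then show ?case by blast
    qed
  qed
  show "{a \<otimes> i | i. i \<in> I} \<subseteq> (PIdl a) \<cdot> I"
    using cgenideal_self[OF assms(1)] ideal_prod.prod by fastforce
qed

text \<open>The recursion is an ideal sum: \<open>PIdl (b [^] n)\<close> plus the product of
  \<open>PIdl a\<close> with the preceding ideal.\<close>

lemma (in cring) ideal_binary_forms:
  assumes "a \<in> carrier R" "b \<in> carrier R"
  shows "ideal (binary_forms R a b n) R"
proof (induction n)
  case 0
  show ?case by (simp add: zeroideal)
next
  case (Suc n)
  have "binary_forms R a b (Suc n) = PIdl (b [^] n) <+> (PIdl a) \<cdot> binary_forms R a b n"
  proof -
    have "(PIdl a) \<cdot> binary_forms R a b n = {a \<otimes> h | h. h \<in> binary_forms R a b n}"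
      using assms(1) Suc by (rule PIdl_prod)
    then show ?thesis
      by (force simp: set_add_def' cgenideal_def)
  qed
  then show ?case
    using Suc assms by (simp add: add_ideals cgenideal_ideal ideal_prod_is_ideal)
qed

text \<open>A form of degree \<open>n - 1\<close> at \<open>(b, a)\<close>, divided by
  \<open>a ^ (n - 1)\<close>, is a polynomial in \<open>b / a\<close> with \<open>n\<close>
  coefficients. Writing the value as \<open>a h / a ^ n\<close> avoids the exponent
  \<open>n - 1\<close> and covers \<open>n = 0\<close>, where \<open>p\<close> is empty.\<close>

lemma (in domain) fraction_is_poly_value:
  assumes "a \<in> carrier R" "a \<noteq> \<zero>" "b \<in> carrier R" "h \<in> binary_forms R a b n"
  shows "\<exists>p. set p \<subseteq> frac_embed R ` carrier R \<and> length p = n \<and>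
    ring.eval (fraction_field R) p (fraction R b a) = fraction R (a \<otimes> h) (a [^] n)"
  using assms(4)
proof (induction n arbitrary: h)
  case 0
  interpret K: ring "fraction_field R" by (rule ring_fraction_field)
  show ?case using 0 assms by (auto simp: zero_fraction_field)
next
  case (Suc n)
  interpret K: ring "fraction_field R" by (rule ring_fraction_field)
  obtain r k where h: "h = r \<otimes> b [^] n \<oplus> a \<otimes> k" "r \<in> carrier R" "k \<in> binary_forms R a b n"
    using Suc.prems by auto
  have k: "k \<in> carrier R" using h(3) binary_forms_subset assms by blast
  obtain p where p: "set p \<subseteq> frac_embed R ` carrier R" "length p = n"
    "K.eval p (fraction R b a) = fraction R (a \<otimes> k) (a [^] n)"
    using Suc.IH[OF h(3)] by blast
  have an: "a [^] i \<noteq> \<zero>" for i :: nat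
    by (induction i) (use assms in \<open>auto simp: integral_iff\<close>)
  \<comment> \<open>The highest coefficient comes first: as \<open>length p = n\<close>, prepending
    \<open>r\<close> adds the term \<open>r (b / a) ^ n\<close>.\<close>
  have "K.eval (frac_embed R r # p) (fraction R b a) = fraction R h (a [^] n)"
    using p h(1,2) assms(1-3) k an
    by (simp add: frac_embed_def fraction_pow fraction_mult fraction_add_same)
  also have "\<dots> = fraction R (a \<otimes> h) (a [^] Suc n)"
    using fraction_cancel[of h "a [^] n" a] h(1,2) k assms(1-3) an by (simp add: m_comm)
  finally show ?case
    using p h(2) by (intro exI[of _ "frac_embed R r # p"]) auto
qed

section \<open>Chain conditions and Noetherian induction on ideals\<close>

context noetherian_ring
begin

text \<open>In a Noetherian ring the union of the chain is one of its members, and the chain is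
  constant from there on.\<close>

lemma ascending_ideals_stationary:
  fixes C :: "nat \<Rightarrow> 'a set"
  assumes "\<And>n. ideal (C n) R" "\<And>n. C n \<subseteq> C (Suc n)"
  shows "\<exists>n. C (Suc n) = C n"
proof -
  have mono: "C m \<subseteq> C n" if "m \<le> n" for m n
    using lift_Suc_mono_le[of C] assms(2) that by blast
  have "subset.chain {I. ideal I R} (range C)"
    unfolding subset_chain_def using assms(1) mono by (auto simp: subset_iff) (metis nat_le_linear)
  then have "\<Union>(range C) \<in> range C"
    by (intro ideal_chain_is_trivial) auto
  then obtain n where "\<Union>(range C) = C n" by auto
  then show ?thesis using assms(2)[of n] by (intro exI[of _ n]) blast
qed

text \<open>The relation puts larger ideals below smaller ones, so that induction along it assumes
  the claim for all strictly larger ideals.\<close>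

lemma wf_ideals: "wf {(J, I). ideal I R \<and> ideal J R \<and> I \<subset> J}"
  unfolding wf_iff_no_infinite_down_chain
proof
  assume "\<exists>C. \<forall>i. (C (Suc i), C i) \<in> {(J, I). ideal I R \<and> ideal J R \<and> I \<subset> J}"
  then obtain C where C: "\<And>i. ideal (C i) R" "\<And>i. C i \<subset> C (Suc i)"
    by simp blast
  then show False using ascending_ideals_stationary[of C] by blast
qed

lemma ideal_induct [consumes 1, case_names ideal]:
  assumes "ideal I R"
    and step: "\<And>I. ideal I R \<Longrightarrow> (\<And>J. ideal J R \<Longrightarrow> I \<subset> J \<Longrightarrow> P J) \<Longrightarrow> P I"
  shows "P I"
  using assms(1)
proof (induction I rule: wf_induct_rule[OF wf_ideals])
  case (1 I)
  then show ?case using step[of I] by auto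
qed

lemma ideals_maximal:
  assumes "I \<in> S" "\<And>I. I \<in> S \<Longrightarrow> ideal I R"
  shows "\<exists>J\<in>S. \<forall>K\<in>S. \<not> J \<subset> K"
proof -
  obtain J where J: "J \<in> S" "\<And>K. (K, J) \<in> {(J, I). ideal I R \<and> ideal J R \<and> I \<subset> J} \<Longrightarrow> K \<notin> S"
    by (rule wfE_min[OF wf_ideals assms(1)]) blast
  have "\<not> J \<subset> K" if "K \<in> S" for K
  proof
    assume "J \<subset> K"
    then have "(K, J) \<in> {(J, I). ideal I R \<and> ideal J R \<and> I \<subset> J}"
      using assms(2)[OF J(1)] assms(2)[OF that] by simp
    from J(2)[OF this] that show False by simp
  qed
  then show ?thesis using J(1) by blast
qed

lemma exists_maximalideal:
  assumes "ideal I R" "I \<noteq> carrier R"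
  obtains P where "maximalideal P R" "I \<subseteq> P"
proof -
  define S where "S = {J. ideal J R \<and> J \<noteq> carrier R \<and> I \<subseteq> J}"
  have "I \<in> S" using assms by (simp add: S_def)
  then have "\<exists>J\<in>S. \<forall>K\<in>S. \<not> J \<subset> K"
    by (rule ideals_maximal) (simp add: S_def)
  then obtain P where P: "P \<in> S" and max: "\<And>K. K \<in> S \<Longrightarrow> \<not> P \<subset> K"
    by blast
  have "maximalideal P R"
  proof (rule maximalidealI)
    fix J assume J: "ideal J R" "P \<subseteq> J" "J \<subseteq> carrier R"
    show "J = P \<or> J = carrier R"
    proof (rule disjCI)
      assume "J \<noteq> carrier R"
      then have "J \<in> S" using J P by (auto simp: S_def)
      from max[OF this] show "J = P" using J by blast
    qed
  qed (use P in \<open>auto simp: S_def\<close>)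
  moreover have "I \<subseteq> P" using P by (simp add: S_def)
  ultimately show ?thesis by (rule that)
qed

end

context dedekind_domain
begin

text \<open>The fraction \<open>b / a\<close> stabilises a nonzero ideal. As \<open>R\<close> is Noetherian, its powers lie in a
  finitely generated module, so it is integral; this needs no determinants.\<close>

lemma divides_if_stabilizes_ideal:
  assumes a: "a \<in> carrier R" "a \<noteq> \<zero>" and b: "b \<in> carrier R"
    and J: "J \<subseteq> carrier R" "J \<noteq> {}" "J \<noteq> {\<zero>}"
    and stab: "\<And>j. j \<in> J \<Longrightarrow> \<exists>k\<in>J. b \<otimes> j = a \<otimes> k"
  shows "b \<in> PIdl a"
proof -
  interpret K: ring "fraction_field R" by (rule ring_fraction_field)
  obtain j where j: "j \<in> J" "j \<noteq> \<zero>" using J(2,3) by blast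
  \<comment> \<open>\<open>g\<close> is multiplication by \<open>b / a\<close> on \<open>J\<close>,
    so \<open>s n\<close> below is \<open>(b / a) ^ n\<close> times \<open>j\<close>.\<close>
  obtain g where g: "\<And>k. k \<in> J \<Longrightarrow> g k \<in> J \<and> b \<otimes> k = a \<otimes> g k"
    using stab by metis
  define s where "s n = (g ^^ n) j" for n
  have sJ: "s n \<in> J" for n by (induction n) (auto simp: s_def j g)
  have sR: "s n \<in> carrier R" and jR: "j \<in> carrier R" for n using sJ j(1) J(1) by auto
  have an: "a [^] i \<noteq> \<zero>" for i :: nat
    by (induction i) (use a in \<open>auto simp: integral_iff\<close>)
  have s_eq: "a [^] n \<otimes> s n = b [^] n \<otimes> j" for n :: nat
  proof (induction n)
    case 0
    show ?case using jR by (simp add: s_def)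
  next
    case (Suc n)
    have "b \<otimes> s n = a \<otimes> s (Suc n)" using g[OF sJ[of n]] by (simp add: s_def)
    then have "a [^] Suc n \<otimes> s (Suc n) = a [^] n \<otimes> (b \<otimes> s n)"
      using a b sR by (simp add: m_assoc)
    also have "\<dots> = b \<otimes> (a [^] n \<otimes> s n)" using a b sR by (simp add: m_ac)
    also have "\<dots> = b [^] Suc n \<otimes> j" using a b jR by (simp add: Suc m_ac)
    finally show ?case .
  qed
  \<comment> \<open>\<open>x \<in> C n\<close> means that \<open>x / j\<close> is an
    \<open>R\<close>-combination of \<open>1, b / a, ..., (b / a) ^ (n - 1)\<close>; the factor
    \<open>a\<close> beside \<open>j\<close> makes up for the degree \<open>n - 1\<close> of the
    forms.\<close>
  define C where "C n = {x \<in> carrier R. a [^] n \<otimes> x \<in> (PIdl (a \<otimes> j)) \<cdot> binary_forms R a b n}"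
    for n :: nat
  note H = binary_forms_subset[OF a(1) b, THEN subsetD]
  have memH: "x \<in> (PIdl (a \<otimes> j)) \<cdot> binary_forms R a b n \<longleftrightarrow>
      (\<exists>h \<in> binary_forms R a b n. x = a \<otimes> j \<otimes> h)" for x n
    using PIdl_prod[OF m_closed[OF a(1) jR] ideal_binary_forms[OF a(1) b]] by auto
  have C_SucI: "x \<in> C (Suc n)"
    if "x \<in> carrier R" "r \<in> carrier R" "h \<in> binary_forms R a b n"
      "a [^] Suc n \<otimes> x = a \<otimes> j \<otimes> (r \<otimes> b [^] n \<oplus> a \<otimes> h)" for x r h n
  proof -
    have "r \<otimes> b [^] n \<oplus> a \<otimes> h \<in> binary_forms R a b (Suc n)" using that(2,3) by auto
    then show ?thesis using that(1,4) unfolding C_def memH by blast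
  qed
  have "ideal (C n) R" for n
  proof -
    interpret I: ideal "(PIdl (a \<otimes> j)) \<cdot> binary_forms R a b n" R
      using a b jR by (intro ideal_prod_is_ideal cgenideal_ideal ideal_binary_forms) auto
    show ?thesis unfolding C_def using a by (intro I.helper_max_prime is_cring) auto
  qed
  moreover have "C n \<subseteq> C (Suc n)" for n
  proof
    fix x assume "x \<in> C n"
    then obtain h where h: "x \<in> carrier R" "h \<in> binary_forms R a b n" "a [^] n \<otimes> x = a \<otimes> j \<otimes> h"
      by (auto simp: C_def memH)
    have "a [^] Suc n \<otimes> x = a \<otimes> (a [^] n \<otimes> x)" using a h by (simp add: m_ac)
    also have "\<dots> = a \<otimes> j \<otimes> (\<zero> \<otimes> b [^] n \<oplus> a \<otimes> h)"
      using h H[OF h(2)] a b jR by (simp add: m_ac)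
    finally show "x \<in> C (Suc n)" using h by (intro C_SucI[of x \<zero> h]) auto
  qed
  ultimately obtain n where n: "C (Suc n) = C n"
    using ascending_ideals_stationary[of C] by blast
  \<comment> \<open>\<open>s n / j\<close> is \<open>(b / a) ^ n\<close>, the spanning element that
    is new in \<open>C (Suc n)\<close>. Stationarity puts \<open>s n\<close> into \<open>C n\<close>
    and so expresses this power through lower ones.\<close>
  have "s n \<in> C (Suc n)"
  proof -
    have "a [^] Suc n \<otimes> s n = a \<otimes> (a [^] n \<otimes> s n)" using a sR by (simp add: m_ac)
    also have "\<dots> = a \<otimes> j \<otimes> (\<one> \<otimes> b [^] n \<oplus> a \<otimes> \<zero>)"
      using a b jR by (simp add: s_eq m_ac)
    finally show ?thesis
      using sR additive_subgroup.zero_closed[OF ideal.axioms(1)[OF ideal_binary_forms[OF a(1) b]]]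
      by (intro C_SucI[of _ \<one> \<zero>]) auto
  qed
  then obtain h where h: "h \<in> binary_forms R a b n" "a [^] n \<otimes> s n = a \<otimes> j \<otimes> h"
    using n by (auto simp: C_def memH)
  have "j \<otimes> b [^] n = j \<otimes> (a \<otimes> h)"
    using h H[OF h(1)] s_eq[of n] a b jR by (simp add: m_ac)
  then have bn: "b [^] n = a \<otimes> h"
    using m_lcancel[of j "b [^] n" "a \<otimes> h"] j(2) jR a b H[OF h(1)] by simp
  obtain p where p: "set p \<subseteq> frac_embed R ` carrier R" "length p = n"
    "K.eval p (fraction R b a) = fraction R (a \<otimes> (\<ominus> h)) (a [^] n)"
    using fraction_is_poly_value[OF a b, of "\<ominus> h" n]
      additive_subgroup.a_inv_closed[OF ideal.axioms(1)[OF ideal_binary_forms[OF a(1) b]] h(1)]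
    by blast
  \<comment> \<open>As \<open>b ^ n = a h\<close>, the value of \<open>p\<close> at
    \<open>b / a\<close> is \<open>- (b / a) ^ n\<close>. Prepending the coefficient
    \<open>1\<close> gives a monic equation for \<open>b / a\<close>.\<close>
  define q where "q = \<one>\<^bsub>fraction_field R\<^esub> # p"
  have one: "\<one>\<^bsub>fraction_field R\<^esub> = frac_embed R \<one>"
    by (simp add: frac_embed_def one_fraction_field)
  have "K.eval q (fraction R b a) = fraction R (b [^] n) (a [^] n)
      \<oplus>\<^bsub>fraction_field R\<^esub> fraction R (a \<otimes> (\<ominus> h)) (a [^] n)"
    using p a b an by (simp add: q_def fraction_pow)
  also have "\<dots> = \<zero>\<^bsub>fraction_field R\<^esub>"
    using bn a an H[OF h(1)]
    by (simp add: fraction_add_same r_minus r_neg zero_fraction_field fraction_eq_iff)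
  finally have "K.eval q (fraction R b a) = \<zero>\<^bsub>fraction_field R\<^esub>" .
  moreover have "polynomial\<^bsub>fraction_field R\<^esub> (frac_embed R ` carrier R) q"
    using p(1) by (auto simp: polynomial_def q_def one frac_embed_def zero_fraction_field fraction_eq_iff)
  ultimately have "integral_over (fraction_field R) (frac_embed R ` carrier R) (fraction R b a)"
    unfolding integral_over_def by (intro exI[of _ q]) (auto simp: univ_poly_carrier q_def)
  then obtain r where "r \<in> carrier R" "fraction R b a = frac_embed R r"
    using integrally_closed a b by (auto simp: integrally_closed_def)
  then have "b = r \<otimes> a"
    using a b by (simp add: frac_embed_def fraction_eq_iff)
  then show ?thesis using \<open>r \<in> carrier R\<close> by (auto simp: cgenideal_def)
qed

end

section \<open>Invertibility of nonzero primes\<close>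

lemma (in cring) ideal_prod_mono:
  "I \<subseteq> I' \<Longrightarrow> J \<subseteq> J' \<Longrightarrow> I \<cdot> J \<subseteq> I' \<cdot> J'"
proof
  fix x assume "I \<subseteq> I'" "J \<subseteq> J'" "x \<in> I \<cdot> J"
  from this(3) show "x \<in> I' \<cdot> J'"
    by (induction rule: ideal_prod.induct)
      (use \<open>I \<subseteq> I'\<close> \<open>J \<subseteq> J'\<close> in \<open>auto intro: ideal_prod.intros\<close>)
qed

lemma (in cring) ideal_prod_least:
  assumes "ideal K R" "\<And>i j. i \<in> I \<Longrightarrow> j \<in> J \<Longrightarrow> i \<otimes> j \<in> K"
  shows "I \<cdot> J \<subseteq> K"
proof
  interpret K: ideal K R by fact
  fix x assume "x \<in> I \<cdot> J"
  then show "x \<in> K" by (induction rule: ideal_prod.induct) (use assms(2) in auto)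
qed

lemma (in cring) mem_PIdl_iff:
  "a \<in> carrier R \<Longrightarrow> x \<in> PIdl a \<longleftrightarrow> (\<exists>r\<in>carrier R. x = a \<otimes> r)"
  by (auto simp: cgenideal_def m_comm)

lemma (in domain) PIdl_prod_subset_cancel:
  assumes "a \<in> carrier R" "a \<noteq> \<zero>" "ideal I R" "ideal J R" "(PIdl a) \<cdot> I \<subseteq> (PIdl a) \<cdot> J"
  shows "I \<subseteq> J"
proof
  fix i assume i: "i \<in> I"
  then have "a \<otimes> i \<in> (PIdl a) \<cdot> J"
    using assms(5) PIdl_prod[OF assms(1,3)] by blast
  then obtain j where "j \<in> J" "a \<otimes> i = a \<otimes> j"
    using PIdl_prod[OF assms(1,4)] by blast
  then show "i \<in> J"
    using m_lcancel[of a i j] assms(1,2) ideal.Icarr[OF assms(3) i] ideal.Icarr[OF assms(4)] by auto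
qed

context dedekind_domain
begin

text \<open>\<open>colon c\<close> is the annihilator of the class of \<open>c\<close> in
  \<open>R / (a)\<close>. One that is maximal among those inside \<open>P\<close> is prime; it
  contains \<open>a\<close>, so it is a maximal ideal and equals \<open>P\<close>. The resulting
  \<open>b / a\<close> maps \<open>P\<close> into \<open>R\<close> without lying in
  \<open>R\<close>.\<close>

lemma exists_annihilator_eq_prime:
  assumes P: "primeideal P R" "P \<noteq> {\<zero>}"
  shows "\<exists>a b. a \<in> carrier R \<and> a \<noteq> \<zero> \<and> b \<in> carrier R \<and> b \<notin> PIdl a \<and>
    (\<forall>p\<in>P. b \<otimes> p \<in> PIdl a)"
proof -
  interpret P: primeideal P R by fact
  obtain a where a: "a \<in> P" "a \<noteq> \<zero>" using P(2) P.zero_closed by blast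
  have aR: "a \<in> carrier R" using a P.Icarr by blast
  interpret A: ideal "PIdl a" R using aR by (rule cgenideal_ideal)
  define colon where "colon c = {x \<in> carrier R. c \<otimes> x \<in> PIdl a}" for c
  define S where "S = {Q. \<exists>c\<in>carrier R. Q = colon c \<and> Q \<subseteq> P}"
  have ideal_colon: "ideal (colon c) R" if "c \<in> carrier R" for c
    unfolding colon_def using is_cring that by (rule A.helper_max_prime)
  have "colon \<one> \<in> S"
    using cgenideal_minimal[OF P.is_ideal a(1)] by (auto simp: S_def colon_def)
  then have "\<exists>Q\<in>S. \<forall>K\<in>S. \<not> Q \<subset> K"
    by (rule ideals_maximal) (auto simp: S_def ideal_colon)
  then obtain Q where Q: "Q \<in> S" "\<forall>K\<in>S. \<not> Q \<subset> K" by blast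
  from Q(1) obtain b where b: "b \<in> carrier R" "colon b \<subseteq> P" "Q = colon b"
    by (auto simp: S_def)
  have max: "\<not> colon b \<subset> K" if "K \<in> S" for K
    using Q(2) b(3) that by simp
  \<comment> \<open>\<open>colon (b \<otimes> c)\<close> contains \<open>colon b\<close> and the new
    element \<open>x\<close>, so by maximality it is not inside \<open>P\<close>; \<open>s\<close>
    is taken from it outside \<open>P\<close>.\<close>
  have bigger: "\<exists>s. s \<in> carrier R \<and> s \<notin> P \<and> b \<otimes> c \<otimes> s \<in> PIdl a"
    if "c \<in> carrier R" "x \<in> carrier R" "x \<notin> colon b" "b \<otimes> c \<otimes> x \<in> PIdl a" for c x
  proof -
    have "colon b \<subseteq> colon (b \<otimes> c)"
    proof
      fix z assume "z \<in> colon b"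
      then have "c \<otimes> (b \<otimes> z) \<in> PIdl a" "z \<in> carrier R"
        using A.I_l_closed that(1) by (auto simp: colon_def)
      then show "z \<in> colon (b \<otimes> c)" using b(1) that(1) by (simp add: colon_def m_ac)
    qed
    then have "colon b \<subset> colon (b \<otimes> c)" using that by (auto simp: colon_def)
    with max[of "colon (b \<otimes> c)"] have "\<not> colon (b \<otimes> c) \<subseteq> P"
      using b(1) that(1) by (auto simp: S_def)
    then show ?thesis by (auto simp: colon_def)
  qed
  have "primeideal (colon b) R"
  proof (rule primeidealI[OF ideal_colon[OF b(1)] is_cring])
    show "carrier R \<noteq> colon b" using b(2) P.I_notcarr P.a_subset by auto
    fix x y assume xy: "x \<in> carrier R" "y \<in> carrier R" "x \<otimes> y \<in> colon b"
    show "x \<in> colon b \<or> y \<in> colon b"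
    proof (rule ccontr)
      assume n: "\<not> (x \<in> colon b \<or> y \<in> colon b)"
      have "b \<otimes> x \<otimes> y \<in> PIdl a" using xy b(1) by (simp add: colon_def m_assoc)
      \<comment> \<open>The factors \<open>y\<close> and \<open>x\<close> are replaced in turn by
        \<open>s\<close> and \<open>t\<close> outside \<open>P\<close>. Then
        \<open>s \<otimes> t\<close> lies in \<open>colon b\<close>, hence in \<open>P\<close>,
        against the primality of \<open>P\<close>.\<close>
      then obtain s where s: "s \<in> carrier R" "s \<notin> P" "b \<otimes> x \<otimes> s \<in> PIdl a"
        using bigger[of x y] xy n by blast
      then have "b \<otimes> s \<otimes> x \<in> PIdl a" using b(1) xy by (simp add: m_ac)
      then obtain t where t: "t \<in> carrier R" "t \<notin> P" "b \<otimes> s \<otimes> t \<in> PIdl a"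
        using bigger[of s x] xy n s by blast
      then have "s \<otimes> t \<in> colon b" using s b(1) by (simp add: colon_def m_assoc)
      then show False using b(2) P.I_prime[of s t] s t by blast
    qed
  qed
  moreover have "a \<in> colon b"
    using b(1) aR A.I_l_closed cgenideal_self[OF aR] by (auto simp: colon_def)
  ultimately interpret Q: maximalideal "colon b" R
    using a(2) nonzero_prime_maximal by blast
  have P_eq: "P = colon b"
    using Q.I_maximal[OF P.is_ideal b(2)] P.I_notcarr P.a_subset by auto
  have "\<one> \<notin> colon b"
    using Q.one_imp_carrier Q.I_notcarr by blast
  then have "b \<otimes> \<one> \<notin> PIdl a" unfolding colon_def using one_closed by blast
  then have "b \<notin> PIdl a" using r_one[OF b(1)] by argo
  moreover have "b \<otimes> p \<in> PIdl a" if "p \<in> P" for p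
  proof -
    from that have "p \<in> colon b" unfolding P_eq .
    then show ?thesis unfolding colon_def by blast
  qed
  ultimately show ?thesis
    using aR a(2) b(1) by blast
qed

text \<open>Invertibility expressed inside \<open>R\<close>: \<open>B / a\<close> is the inverse of
  \<open>P\<close>, and the last conjunct says that this inverse is not contained in
  \<open>R\<close>.\<close>

lemma prime_invertible:
  assumes P: "primeideal P R" "P \<noteq> {\<zero>}"
  shows "\<exists>a B. a \<in> carrier R \<and> a \<noteq> \<zero> \<and> ideal B R \<and> P \<cdot> B = PIdl a \<and> \<not> B \<subseteq> PIdl a"
proof -
  interpret P: primeideal P R by fact
  interpret P: maximalideal P R using P by (rule nonzero_prime_maximal)
  obtain a b where a: "a \<in> carrier R" "a \<noteq> \<zero>" and b: "b \<in> carrier R" "b \<notin> PIdl a"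
    and bP: "\<And>p. p \<in> P \<Longrightarrow> b \<otimes> p \<in> PIdl a"
    using exists_annihilator_eq_prime[OF P] by blast
  interpret A: ideal "PIdl a" R using a(1) by (rule cgenideal_ideal)
  \<comment> \<open>\<open>B\<close> is the colon ideal of \<open>PIdl a\<close> by
    \<open>P\<close>; it contains both \<open>a\<close> and the \<open>b\<close> obtained
    above.\<close>
  define B where "B = (\<Inter>p\<in>P. {y \<in> carrier R. p \<otimes> y \<in> PIdl a})"
  have B: "y \<in> B \<longleftrightarrow> y \<in> carrier R \<and> (\<forall>p\<in>P. p \<otimes> y \<in> PIdl a)" for y
    unfolding B_def using P.zero_closed by blast
  have "ideal {y \<in> carrier R. p \<otimes> y \<in> PIdl a} R" if "p \<in> P" for p
    using is_cring P.Icarr[OF that] by (rule A.helper_max_prime)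
  then have idealB: "ideal B R"
    unfolding B_def using P.zero_closed by (intro i_Intersect) blast+
  have PB: "ideal (P \<cdot> B) R" using P.is_ideal idealB by (rule ideal_prod_is_ideal)
  then interpret PB: ideal "P \<cdot> B" R .
  define C where "C = {c \<in> carrier R. a \<otimes> c \<in> P \<cdot> B}"
  have idealC: "ideal C R"
    unfolding C_def using is_cring a(1) by (rule PB.helper_max_prime)
  have bB: "b \<in> B"
    using bP b(1) P.Icarr by (auto simp: B m_comm)
  have aB: "a \<in> B"
    using a(1) cgenideal_self[OF a(1)] A.I_l_closed P.Icarr by (auto simp: B)
  have "P \<subseteq> C"
  proof
    fix p assume p: "p \<in> P"
    then have "p \<otimes> a \<in> P \<cdot> B" using aB by (rule ideal_prod.prod)
    then show "p \<in> C" using p P.Icarr a(1) by (auto simp: C_def m_comm)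
  qed
  \<comment> \<open>\<open>C\<close> is \<open>P \<cdot> B\<close> divided by \<open>a\<close>. It
    contains \<open>P\<close>, so maximality leaves \<open>P\<close> or \<open>R\<close>. If it were
    \<open>P\<close>, then \<open>b / a\<close> would map \<open>P\<close> into itself and lie in
    \<open>R\<close> by integral closedness.\<close>
  have "C = carrier R"
  proof (rule ccontr)
    assume "C \<noteq> carrier R"
    then have "C = P"
      using P.I_maximal[OF idealC \<open>P \<subseteq> C\<close>] additive_subgroup.a_subset[OF ideal.axioms(1)[OF idealC]]
      by blast
    have "\<exists>k\<in>P. b \<otimes> p = a \<otimes> k" if p: "p \<in> P" for p
    proof -
      obtain k where k: "k \<in> carrier R" "b \<otimes> p = a \<otimes> k"
        using bP[OF p] mem_PIdl_iff[OF a(1)] by blast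
      have "p \<otimes> b \<in> P \<cdot> B" using p bB by (rule ideal_prod.prod)
      then have "k \<in> C" using k b(1) P.Icarr[OF p] by (simp add: C_def m_comm)
      then show ?thesis using k \<open>C = P\<close> by blast
    qed
    moreover have "P \<noteq> {}" using P.zero_closed by blast
    ultimately have "b \<in> PIdl a"
      using divides_if_stabilizes_ideal[OF a b(1) P.a_subset _ assms(2)] by blast
    then show False using b(2) by simp
  qed
  then have "\<one> \<in> C" by simp
  then have "a \<in> P \<cdot> B" using a(1) by (simp add: C_def)
  then have "PIdl a \<subseteq> P \<cdot> B" by (rule cgenideal_minimal[OF PB])
  moreover have "P \<cdot> B \<subseteq> PIdl a"
    by (rule ideal_prod_least[OF A.is_ideal]) (simp add: B)
  ultimately show ?thesis
    using a idealB bB b(2) by (intro exI[of _ a] exI[of _ B]) blast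
qed

text \<open>Multiplying by \<open>B\<close> turns the inclusion into one between
  \<open>(PIdl a) \<cdot> I\<close> and \<open>(PIdl a) \<cdot> J\<close>, where the nonzero
  \<open>a\<close> cancels.\<close>

lemma prime_prod_subset_cancel:
  assumes P: "primeideal P R" "P \<noteq> {\<zero>}" and I: "ideal I R" and J: "ideal J R"
    and sub: "P \<cdot> I \<subseteq> P \<cdot> J"
  shows "I \<subseteq> J"
proof -
  obtain a B where a: "a \<in> carrier R" "a \<noteq> \<zero>" and B: "ideal B R" "P \<cdot> B = PIdl a"
    using prime_invertible[OF P] by blast
  have P': "ideal P R" using P(1) by (rule primeideal.axioms)
  have eq: "(PIdl a) \<cdot> K = B \<cdot> (P \<cdot> K)" if "ideal K R" for K
    using ideal_prod_assoc[OF B(1) P' that] ideal_prod_commute[OF B(1) P'] B(2) by simp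
  show ?thesis
    using a I J
    by (rule PIdl_prod_subset_cancel) (simp add: eq I J ideal_prod_mono[OF subset_refl sub])
qed

text \<open>\<open>J'\<close> is \<open>J\<close> times the inverse of \<open>P\<close>, that is
  \<open>B \<cdot> J\<close> divided by \<open>a\<close>; it lies in \<open>R\<close> because
  \<open>J \<subseteq> P\<close>. The strict growth drives the Noetherian inductions below.\<close>

lemma prime_divides_ideal:
  assumes P: "primeideal P R" "P \<noteq> {\<zero>}" and J: "ideal J R" "J \<subseteq> P"
  obtains J' where "ideal J' R" "J = P \<cdot> J'" "J \<noteq> {\<zero>} \<longrightarrow> J \<subset> J'"
proof -
  obtain a B where a: "a \<in> carrier R" "a \<noteq> \<zero>" and B: "ideal B R" "P \<cdot> B = PIdl a"
      "\<not> B \<subseteq> PIdl a"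
    using prime_invertible[OF P] by blast
  have P': "ideal P R" using P(1) by (rule primeideal.axioms)
  interpret J: ideal J R by fact
  have BJ: "ideal (B \<cdot> J) R" using B(1) J(1) by (rule ideal_prod_is_ideal)
  have BJ_sub: "B \<cdot> J \<subseteq> PIdl a"
    using ideal_prod_mono[OF subset_refl J(2), of B] ideal_prod_commute[OF B(1) P'] B(2) by simp
  define J' where "J' = {y \<in> carrier R. a \<otimes> y \<in> B \<cdot> J}"
  have J': "ideal J' R"
    unfolding J'_def using is_cring a(1) by (rule ideal.helper_max_prime[OF BJ])
  have aJ': "(PIdl a) \<cdot> J' = B \<cdot> J"
  proof
    show "(PIdl a) \<cdot> J' \<subseteq> B \<cdot> J"
      using PIdl_prod[OF a(1) J'] by (auto simp: J'_def)
    show "B \<cdot> J \<subseteq> (PIdl a) \<cdot> J'"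
    proof
      fix x assume x: "x \<in> B \<cdot> J"
      then obtain r where "r \<in> carrier R" "x = a \<otimes> r"
        using BJ_sub mem_PIdl_iff[OF a(1)] by blast
      then show "x \<in> (PIdl a) \<cdot> J'"
        using x PIdl_prod[OF a(1) J'] by (auto simp: J'_def)
    qed
  qed
  have PJ': "ideal (P \<cdot> J') R" using P' J' by (rule ideal_prod_is_ideal)
  have A: "ideal (PIdl a) R" using a(1) by (rule cgenideal_ideal)
  have "(PIdl a) \<cdot> (P \<cdot> J') = P \<cdot> ((PIdl a) \<cdot> J')"
    using ideal_prod_assoc[OF A P' J'] ideal_prod_assoc[OF P' A J'] ideal_prod_commute[OF A P']
    by simp
  also have "\<dots> = (PIdl a) \<cdot> J"
    using ideal_prod_assoc[OF P' B(1) J(1)] by (simp add: aJ' B(2))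
  finally have eq: "J = P \<cdot> J'"
    using PIdl_prod_subset_cancel[OF a PJ' J(1)] PIdl_prod_subset_cancel[OF a J(1) PJ'] by blast
  have "J \<noteq> J'" if "J \<noteq> {\<zero>}"
  proof
    \<comment> \<open>Now \<open>B \<cdot> J\<close> equals \<open>(PIdl a) \<cdot> J\<close>, so
      every \<open>b / a\<close> with \<open>b \<in> B\<close> stabilises the nonzero ideal
      \<open>J\<close> and lies in \<open>R\<close>, against the choice of \<open>B\<close>.\<close>
    assume "J = J'"
    have "B \<subseteq> PIdl a"
    proof
      fix b assume b: "b \<in> B"
      have "\<exists>k\<in>J. b \<otimes> j = a \<otimes> k" if "j \<in> J" for j
      proof -
        have "b \<otimes> j \<in> (PIdl a) \<cdot> J"
          using ideal_prod.prod[OF b that, of R] aJ' \<open>J = J'\<close> by simp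
        then show ?thesis using PIdl_prod[OF a(1) J(1)] by blast
      qed
      moreover have "J \<noteq> {}" using J.zero_closed by blast
      ultimately show "b \<in> PIdl a"
        using divides_if_stabilizes_ideal[OF a ideal.Icarr[OF B(1) b] J.a_subset _ that] by blast
    qed
    then show False using B(3) by simp
  qed
  moreover have "J \<subseteq> J'"
    using ideal_prod_inter[OF P' J'] eq by blast
  ultimately have "J \<noteq> {\<zero>} \<longrightarrow> J \<subset> J'" by blast
  then show ?thesis using that J' eq by simp
qed

end

section \<open>Prime powers and comaximal ideals\<close>

lemma (in cring) ideal_power_0 [simp]: "ideal_power R P 0 = carrier R"
  by (simp add: ideal_power_def ideals_set_def)

lemma (in cring) ideal_power_Suc [simp]: "ideal_power R P (Suc n) = ideal_power R P n \<cdot> P"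
  by (simp add: ideal_power_def ideals_set_def)

lemma (in cring) ideal_ideal_power: "ideal P R \<Longrightarrow> ideal (ideal_power R P n) R"
  by (induction n) (simp_all add: oneideal ideal_prod_is_ideal)

lemma (in cring) ideal_power_antimono:
  assumes "ideal P R" "m \<le> n"
  shows "ideal_power R P n \<subseteq> ideal_power R P m"
proof -
  have "ideal_power R P (Suc k) \<subseteq> ideal_power R P k" for k
    using ideal_prod_inter[OF ideal_ideal_power[OF assms(1)] assms(1)] by auto
  from lift_Suc_antimono_le[of "ideal_power R P", OF this assms(2)] show ?thesis .
qed

lemma (in cring) ideal_power_subset:
  assumes "ideal P R" "n > 0"
  shows "ideal_power R P n \<subseteq> P"
proof -
  have "ideal_power R P 1 = P"
    using ideal_prod_one[OF assms(1)] ideal_prod_commute[OF assms(1) oneideal] by simp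
  then show ?thesis using ideal_power_antimono[OF assms(1), of 1 n] assms(2) by simp
qed

section \<open>Comaximal ideals\<close>

lemma (in cring) comaximal_iff:
  assumes "ideal I R" "ideal J R"
  shows "I <+> J = carrier R \<longleftrightarrow> (\<exists>i\<in>I. \<exists>j\<in>J. i \<oplus> j = \<one>)"
proof
  assume "I <+> J = carrier R"
  then have "\<one> \<in> I <+> J" by simp
  then obtain i j where "i \<in> I" "j \<in> J" "\<one> = i \<oplus> j" by (auto simp: set_add_def')
  then show "\<exists>i\<in>I. \<exists>j\<in>J. i \<oplus> j = \<one>" by metis
next
  assume "\<exists>i\<in>I. \<exists>j\<in>J. i \<oplus> j = \<one>"
  then have "\<one> \<in> I <+> J" by (force simp: set_add_def')
  then show "I <+> J = carrier R"
    using ideal.one_imp_carrier[OF add_ideals[OF assms]] by blast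
qed

lemma (in cring) comaximal_carrier:
  assumes "ideal I R"
  shows "I <+> carrier R = carrier R"
  using comaximal_iff[OF assms oneideal] l_zero[OF one_closed]
    additive_subgroup.zero_closed[OF ideal.axioms(1)[OF assms]] one_closed by blast

lemma (in cring) comaximal_prod:
  assumes "ideal I R" "ideal J R" "ideal K R"
    and "I <+> J = carrier R" "I <+> K = carrier R"
  shows "I <+> J \<cdot> K = carrier R"
proof -
  interpret I: ideal I R by fact
  interpret J: ideal J R by fact
  interpret K: ideal K R by fact
  obtain i j where ij: "i \<in> I" "j \<in> J" "i \<oplus> j = \<one>"
    using assms comaximal_iff by blast
  obtain i' k where ik: "i' \<in> I" "k \<in> K" "i' \<oplus> k = \<one>"
    using assms comaximal_iff by blast
  note car = I.Icarr[OF ij(1)] J.Icarr[OF ij(2)] I.Icarr[OF ik(1)] K.Icarr[OF ik(2)]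
  \<comment> \<open>In the expansion of \<open>(i \<oplus> j) \<otimes> (i' \<oplus> k)\<close>
    every term except \<open>j \<otimes> k\<close> lies in \<open>I\<close>.\<close>
  have "(i \<otimes> (i' \<oplus> k) \<oplus> j \<otimes> i') \<oplus> j \<otimes> k = (i \<oplus> j) \<otimes> (i' \<oplus> k)"
    using car by (simp add: l_distr r_distr a_ac)
  also have "\<dots> = \<one>" unfolding ij(3) ik(3) by simp
  finally have "(i \<otimes> (i' \<oplus> k) \<oplus> j \<otimes> i') \<oplus> j \<otimes> k = \<one>" .
  moreover have "i \<otimes> (i' \<oplus> k) \<oplus> j \<otimes> i' \<in> I"
    using car ij(1) ik(1) by (intro I.a_closed I.I_r_closed I.I_l_closed) auto
  moreover have "j \<otimes> k \<in> J \<cdot> K" using ij(2) ik(2) by (rule ideal_prod.prod)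
  ultimately show ?thesis
    using comaximal_iff[OF assms(1) ideal_prod_is_ideal[OF assms(2,3)]] by blast
qed

lemma (in cring) comaximal_Int:
  assumes "ideal I R" "ideal J R" "ideal K R"
    and "I <+> J = carrier R" "I <+> K = carrier R"
  shows "I <+> (J \<inter> K) = carrier R"
proof -
  have "\<exists>i\<in>I. \<exists>j\<in>J \<cdot> K. i \<oplus> j = \<one>"
    using comaximal_prod[OF assms] comaximal_iff[OF assms(1) ideal_prod_is_ideal[OF assms(2,3)]]
    by blast
  then show ?thesis
    using ideal_prod_inter[OF assms(2,3)] comaximal_iff[OF assms(1) i_intersect[OF assms(2,3)]]
    by blast
qed

lemma (in cring) comaximal_power:
  assumes "ideal I R" "ideal J R" "I <+> J = carrier R"
  shows "I <+> ideal_power R J n = carrier R"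
proof (induction n)
  case 0
  show ?case using comaximal_carrier[OF assms(1)] by simp
next
  case (Suc n)
  show ?case
    using comaximal_prod[OF assms(1) ideal_ideal_power[OF assms(2)] assms(2) Suc assms(3)] by simp
qed

text \<open>\<open>comaximal_power\<close> acts on the second summand only; commuting the sum lets
  it act on each in turn.\<close>

lemma (in cring) comaximal_powers:
  assumes "ideal I R" "ideal J R" "I <+> J = carrier R"
  shows "ideal_power R I m <+> ideal_power R J n = carrier R"
proof -
  interpret I: ideal I R by fact
  interpret J: ideal J R by fact
  interpret Im: ideal "ideal_power R I m" R using assms(1) by (rule ideal_ideal_power)
  have "J <+> I = carrier R"
    using set_add_comm[OF I.a_subset J.a_subset] assms(3) by simp
  then have "J <+> ideal_power R I m = carrier R"
    by (rule comaximal_power[OF J.is_ideal I.is_ideal])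
  then have "ideal_power R I m <+> J = carrier R"
    using set_add_comm[OF Im.a_subset J.a_subset] by simp
  then show ?thesis by (rule comaximal_power[OF Im.is_ideal J.is_ideal])
qed

text \<open>Intersecting with \<open>carrier R\<close> makes the empty family give the unit ideal
  instead of the whole type, so that inductions on \<open>F\<close> can start there.\<close>

lemma (in cring) ideal_Int_INT:
  assumes "\<And>x. x \<in> F \<Longrightarrow> ideal (g x) R"
  shows "ideal (carrier R \<inter> (\<Inter>x\<in>F. g x)) R"
  using i_Intersect[of "insert (carrier R) (g ` F)"] assms oneideal by auto

lemma (in cring) comaximal_INT:
  assumes "finite F" "ideal I R" "\<And>x. x \<in> F \<Longrightarrow> ideal (g x) R"
    and "\<And>x. x \<in> F \<Longrightarrow> I <+> g x = carrier R"
  shows "I <+> (carrier R \<inter> (\<Inter>x\<in>F. g x)) = carrier R"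
  using assms(1,3,4)
proof (induction F)
  case empty
  show ?case using comaximal_carrier[OF assms(2)] by simp
next
  case (insert x F)
  have K: "ideal (carrier R \<inter> (\<Inter>x\<in>F. g x)) R"
    by (rule ideal_Int_INT) (use insert in auto)
  have "I <+> (g x \<inter> (carrier R \<inter> (\<Inter>x\<in>F. g x))) = carrier R"
    by (rule comaximal_Int[OF assms(2) _ K]) (use insert in auto)
  moreover have "g x \<inter> (carrier R \<inter> (\<Inter>x\<in>F. g x)) = carrier R \<inter> (\<Inter>x\<in>insert x F. g x)"
    by auto
  ultimately show ?case by simp
qed

section \<open>Prime divisors and prime powers above a nonzero ideal\<close>

context dedekind_domain
begin

lemma nonzero_prime_subset_eq:
  assumes "primeideal P R" "P \<noteq> {\<zero>}" "primeideal Q R" "P \<subseteq> Q"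
  shows "P = Q"
proof -
  interpret P: maximalideal P R using assms(1,2) by (rule nonzero_prime_maximal)
  interpret Q: primeideal Q R by fact
  show ?thesis using P.I_maximal[OF Q.is_ideal assms(4) Q.a_subset] Q.I_notcarr by auto
qed

text \<open>Distinct nonzero primes are incomparable, so the sum is strictly larger than the maximal
  ideal \<open>P\<close>.\<close>

lemma comaximal_primes:
  assumes P: "primeideal P R" "P \<noteq> {\<zero>}" and Q: "primeideal Q R" "Q \<noteq> {\<zero>}"
    and "P \<noteq> Q"
  shows "P <+> Q = carrier R"
proof -
  interpret P: maximalideal P R using P by (rule nonzero_prime_maximal)
  interpret Q: primeideal Q R by fact
  have sub: "P \<union> Q \<subseteq> P <+> Q"
    using genideal_self[of "P \<union> Q"] union_genideal[OF P.is_ideal Q.is_ideal]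
      P.a_subset Q.a_subset by simp
  have PQ: "ideal (P <+> Q) R" using P.is_ideal Q.is_ideal by (rule add_ideals)
  have "P <+> Q \<noteq> P"
    using sub nonzero_prime_subset_eq[OF Q P(1)] \<open>P \<noteq> Q\<close> by blast
  then show ?thesis
    using P.I_maximal[OF PQ] sub additive_subgroup.a_subset[OF ideal.axioms(1)[OF PQ]] by blast
qed

text \<open>The induction step for nonzero proper ideals: a maximal ideal above \<open>J\<close> is
  a nonzero prime and splits off from \<open>J\<close>.\<close>

lemma exists_prime_divisor:
  assumes "ideal J R" "J \<noteq> {\<zero>}" "J \<noteq> carrier R"
  obtains P J' where "primeideal P R" "P \<noteq> {\<zero>}" "ideal J' R" "J = P \<cdot> J'" "J \<subset> J'"
proof -
  obtain P where P: "maximalideal P R" "J \<subseteq> P"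
    using assms(1,3) by (rule exists_maximalideal)
  have prime: "primeideal P R" using P(1) by (rule maximalideal_prime)
  have nz: "P \<noteq> {\<zero>}"
    using P(2) assms(2) additive_subgroup.zero_closed[OF ideal.axioms(1)[OF assms(1)]] by blast
  obtain J' where "ideal J' R" "J = P \<cdot> J'" "J \<noteq> {\<zero>} \<longrightarrow> J \<subset> J'"
    using prime nz assms(1) P(2) by (rule prime_divides_ideal)
  then show ?thesis using that[OF prime nz] assms(2) by simp
qed

lemma nonzero_supset:
  assumes "ideal J R" "J \<noteq> {\<zero>}" "J \<subset> J'"
  shows "J' \<noteq> {\<zero>}"
  using assms additive_subgroup.zero_closed[OF ideal.axioms(1)[OF assms(1)]] by blast

text \<open>Noetherian induction with \<open>J = P \<cdot> J'\<close>: a prime above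
  \<open>J\<close> contains \<open>J'\<close>, or else contains \<open>P\<close> and then equals it.
  So only \<open>P\<close> can be added to the primes above \<open>J'\<close>.\<close>

lemma finite_primes_containing:
  assumes "ideal J R" "J \<noteq> {\<zero>}"
  shows "finite {P. primeideal P R \<and> J \<subseteq> P}"
  using assms
proof (induction J rule: ideal_induct)
  case (ideal J)
  show ?case
  proof (cases "J = carrier R")
    case True
    have "\<not> J \<subseteq> P" if "primeideal P R" for P
      using True primeideal.I_notcarr[OF that]
        additive_subgroup.a_subset[OF ideal.axioms(1)[OF primeideal.axioms(1)[OF that]]] by blast
    then have "{P. primeideal P R \<and> J \<subseteq> P} = {}" by blast
    then show ?thesis by (simp only: finite.emptyI)
  next
    case False
    obtain P J' where P: "primeideal P R" "P \<noteq> {\<zero>}" and J': "ideal J' R" "J = P \<cdot> J'" "J \<subset> J'"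
      using ideal(1,3) False by (rule exists_prime_divisor)
    have fin: "finite {P. primeideal P R \<and> J' \<subseteq> P}"
      using ideal.IH[OF J'(1,3)] nonzero_supset[OF ideal(1,3) J'(3)] by blast
    have "Q = P \<or> J' \<subseteq> Q" if Q: "primeideal Q R" "J \<subseteq> Q" for Q
    proof (rule disjCI)
      assume "\<not> J' \<subseteq> Q"
      then obtain y where y: "y \<in> J'" "y \<notin> Q" by blast
      interpret Q: primeideal Q R by fact
      have "P \<subseteq> Q"
      proof
        fix p assume p: "p \<in> P"
        have "p \<otimes> y \<in> Q" using ideal_prod.prod[OF p y(1), of R] J'(2) Q(2) by blast
        moreover have "p \<in> carrier R" using p by (rule ideal.Icarr[OF primeideal.axioms(1)[OF P(1)]])
        moreover have "y \<in> carrier R" using y(1) by (rule ideal.Icarr[OF J'(1)])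
        ultimately show "p \<in> Q" using Q.I_prime[of p y] y(2) by blast
      qed
      then show "Q = P" using nonzero_prime_subset_eq[OF P Q(1)] by blast
    qed
    then have "{Q. primeideal Q R \<and> J \<subseteq> Q} \<subseteq> insert P {Q. primeideal Q R \<and> J' \<subseteq> Q}" by blast
    then show ?thesis using fin by (meson finite.insertI finite_subset)
  qed
qed

lemma subset_prime_power_Suc_iff:
  assumes P: "primeideal P R" "P \<noteq> {\<zero>}" and J: "ideal J R"
  shows "P \<cdot> J \<subseteq> ideal_power R P (Suc n) \<longleftrightarrow> J \<subseteq> ideal_power R P n"
proof -
  have P': "ideal P R" using P(1) by (rule primeideal.axioms)
  note Pn = ideal_ideal_power[OF P', of n]
  have eq: "ideal_power R P (Suc n) = P \<cdot> ideal_power R P n"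
    using ideal_prod_commute[OF Pn P'] by simp
  show ?thesis
    unfolding eq using prime_prod_subset_cancel[OF P J Pn] ideal_prod_mono[OF subset_refl] by blast
qed

text \<open>Stands in for Krull's intersection theorem.\<close>

lemma not_subset_prime_power:
  assumes "ideal J R" "J \<noteq> {\<zero>}" and P: "primeideal P R" "P \<noteq> {\<zero>}"
  shows "\<exists>n. \<not> J \<subseteq> ideal_power R P n"
  using assms(1,2)
proof (induction J rule: ideal_induct)
  case (ideal J)
  have P': "ideal P R" using P(1) by (rule primeideal.axioms)
  show ?case
  proof (cases "J \<subseteq> P")
    case False
    then have "\<not> J \<subseteq> ideal_power R P 1"
      using ideal_power_subset[OF P', of 1] by auto
    then show ?thesis by blast
  next
    case True
    \<comment> \<open>\<open>J'\<close> is \<open>J\<close> divided by \<open>P\<close> and strictly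
      larger. An exponent \<open>n\<close> that works for \<open>J'\<close> becomes
      \<open>Suc n\<close> after multiplying back by \<open>P\<close>.\<close>
    obtain J' where J': "ideal J' R" "J = P \<cdot> J'" "J \<noteq> {\<zero>} \<longrightarrow> J \<subset> J'"
      using P ideal(1) True by (rule prime_divides_ideal)
    obtain n where "\<not> J' \<subseteq> ideal_power R P n"
      using ideal.IH[OF J'(1) J'(3)[THEN mp, OF ideal(3)]] nonzero_supset[OF ideal(1,3) J'(3)[THEN mp, OF ideal(3)]]
      by blast
    then have "\<not> J \<subseteq> ideal_power R P (Suc n)"
      using subset_prime_power_Suc_iff[OF P J'(1)] J'(2) by blast
    then show ?thesis by blast
  qed
qed

text \<open>Takes the place of comparing exponents in prime factorisations. A prime divisor
  \<open>P\<close> of \<open>J\<close> is split off from both ideals; \<open>I\<close> is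
  generalised because the induction continues with its cofactor \<open>I'\<close>.\<close>

lemma subset_if_prime_powers:
  assumes "ideal J R" "J \<noteq> {\<zero>}" "ideal I R"
    and "\<And>P m. primeideal P R \<Longrightarrow> P \<noteq> {\<zero>} \<Longrightarrow> J \<subseteq> ideal_power R P m \<Longrightarrow> I \<subseteq> ideal_power R P m"
  shows "I \<subseteq> J"
  using assms
proof (induction J arbitrary: I rule: ideal_induct)
  case (ideal J)
  show ?case
  proof (cases "J = carrier R")
    case True
    then show ?thesis
      using additive_subgroup.a_subset[OF ideal.axioms(1)[OF ideal.prems(2)]] by simp
  next
    case False
    obtain P J' where P: "primeideal P R" "P \<noteq> {\<zero>}" and J': "ideal J' R" "J = P \<cdot> J'" "J \<subset> J'"
      using ideal.hyps ideal.prems(1) False by (rule exists_prime_divisor)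
    have P': "ideal P R" using P(1) by (rule primeideal.axioms)
    have "ideal_power R P 1 = P"
      using ideal_prod_commute[OF oneideal P'] ideal_prod_one[OF P'] by simp
    then have "I \<subseteq> P"
      using ideal.prems(3)[OF P, of 1] ideal_prod_inter[OF P' J'(1)] J'(2) by simp
    with P ideal.prems(2) obtain I' where I': "ideal I' R" "I = P \<cdot> I'"
      by (rule prime_divides_ideal)
    \<comment> \<open>The hypothesis must pass to the pair \<open>I'\<close>, \<open>J'\<close>. For
      \<open>Q = P\<close> the exponent shifts by one. Otherwise \<open>1 = p + q\<close> with
      \<open>p \<in> P\<close> and \<open>q\<close> in the power of \<open>Q\<close>, and in
      \<open>y = p y + q y\<close> the first term lies in \<open>I\<close>.\<close>
    have "I' \<subseteq> ideal_power R Q m"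
      if Q: "primeideal Q R" "Q \<noteq> {\<zero>}" and sub: "J' \<subseteq> ideal_power R Q m" for Q m
    proof (cases "Q = P")
      case True
      then have "J \<subseteq> ideal_power R P (Suc m)"
        using sub subset_prime_power_Suc_iff[OF P J'(1)] J'(2) by blast
      then have "I \<subseteq> ideal_power R P (Suc m)" by (rule ideal.prems(3)[OF P])
      then show ?thesis
        using subset_prime_power_Suc_iff[OF P I'(1)] I'(2) True by blast
    next
      case False
      have Q': "ideal Q R" using Q(1) by (rule primeideal.axioms)
      interpret Qm: ideal "ideal_power R Q m" R using Q' by (rule ideal_ideal_power)
      have "P <+> ideal_power R Q m = carrier R"
        using comaximal_power[OF P' Q'] comaximal_primes[OF P Q] False by blast
      then obtain p q where pq: "p \<in> P" "q \<in> ideal_power R Q m" "p \<oplus> q = \<one>"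
        using comaximal_iff[OF P' Qm.is_ideal] by blast
      have "J \<subseteq> ideal_power R Q m" using sub J'(3) by blast
      then have I: "I \<subseteq> ideal_power R Q m" by (rule ideal.prems(3)[OF Q])
      show ?thesis
      proof
        fix y assume y: "y \<in> I'"
        have yR: "y \<in> carrier R" using y by (rule ideal.Icarr[OF I'(1)])
        have "p \<otimes> y \<in> ideal_power R Q m"
          using ideal_prod.prod[OF pq(1) y, of R] I'(2) I by blast
        moreover have "q \<otimes> y \<in> ideal_power R Q m" using pq(2) yR by (rule Qm.I_r_closed)
        ultimately have "p \<otimes> y \<oplus> q \<otimes> y \<in> ideal_power R Q m" by (rule Qm.a_closed)
        moreover have "p \<otimes> y \<oplus> q \<otimes> y = y"
          using l_distr[OF ideal.Icarr[OF P' pq(1)] Qm.Icarr[OF pq(2)] yR] pq(3) yR by simp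
        ultimately show "y \<in> ideal_power R Q m" by simp
      qed
    qed
    then have "I' \<subseteq> J'"
      using ideal.IH[OF J'(1,3) nonzero_supset[OF ideal.hyps ideal.prems(1) J'(3)] I'(1)] by blast
    then show ?thesis unfolding I'(2) J'(2) by (rule ideal_prod_mono[OF subset_refl])
  qed
qed

end

section \<open>Ideal multiples of a module and content\<close>

context module
begin

lemma submodule_ideal_mult:
  assumes "ideal I R"
  shows "submodule (ideal_mult M I) R M"
proof (rule submodule.intro)
  interpret I: ideal I R by fact
  let ?S = "{r \<odot>\<^bsub>M\<^esub> x | r x. r \<in> I \<and> x \<in> carrier M}"
  have S: "?S \<subseteq> carrier (add_monoid M)" using I.Icarr by auto
  show sub: "subgroup (ideal_mult M I) (add_monoid M)"
    unfolding ideal_mult_def using S by (rule group.generate_is_subgroup[OF M.a_group])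
  show "submodule_axioms (ideal_mult M I) R M"
  proof
    fix a x assume a: "a \<in> carrier R" and "x \<in> ideal_mult M I"
    from this(2) show "a \<odot>\<^bsub>M\<^esub> x \<in> ideal_mult M I"
      unfolding ideal_mult_def
    proof (induction rule: generate.induct)
      case one
      show ?case using a generate.one[of "add_monoid M" ?S] by simp
    next
      case (incl h)
      then obtain r x where h: "h = r \<odot>\<^bsub>M\<^esub> x" "r \<in> I" "x \<in> carrier M" by blast
      then have "a \<odot>\<^bsub>M\<^esub> h = (a \<otimes> r) \<odot>\<^bsub>M\<^esub> x"
        using a I.Icarr smult_assoc1 by simp
      moreover have "a \<otimes> r \<in> I" using h(2) a by (rule I.I_l_closed)
      ultimately show ?case using h(3) by (intro generate.incl) blast
    next
      case (inv h)
      then obtain r x where h: "h = r \<odot>\<^bsub>M\<^esub> x" "r \<in> I" "x \<in> carrier M" by blast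
      then have "a \<odot>\<^bsub>M\<^esub> (\<ominus>\<^bsub>M\<^esub> h) = (a \<otimes> r) \<odot>\<^bsub>M\<^esub> (\<ominus>\<^bsub>M\<^esub> x)"
        using a I.Icarr smult_assoc1 by (simp add: smult_r_minus)
      moreover have "a \<otimes> r \<in> I" using h(2) a by (rule I.I_l_closed)
      moreover have "\<ominus>\<^bsub>M\<^esub> x \<in> carrier M" using h(3) by simp
      ultimately have "a \<odot>\<^bsub>M\<^esub> (\<ominus>\<^bsub>M\<^esub> h) \<in> generate (add_monoid M) ?S"
        by (intro generate.incl) blast
      then show ?case by (simp add: a_inv_def)
    next
      case (eng h1 h2)
      have "h1 \<in> carrier M" "h2 \<in> carrier M"
        using eng.hyps subgroup.subset[OF sub] by (auto simp: ideal_mult_def)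
      then have "a \<odot>\<^bsub>M\<^esub> (h1 \<oplus>\<^bsub>M\<^esub> h2) = a \<odot>\<^bsub>M\<^esub> h1 \<oplus>\<^bsub>M\<^esub> a \<odot>\<^bsub>M\<^esub> h2"
        by (rule smult_r_distr[OF a])
      then show ?case using generate.eng[OF eng.IH] by simp
    qed
  qed
qed

lemma ideal_mult_mono: "I \<subseteq> J \<Longrightarrow> ideal_mult M I \<subseteq> ideal_mult M J"
  unfolding ideal_mult_def by (rule group.mono_generate[OF M.a_group]) blast

lemma ideal_mult_least:
  assumes N: "submodule N R M" and gen: "\<And>r x. r \<in> I \<Longrightarrow> x \<in> carrier M \<Longrightarrow> r \<odot>\<^bsub>M\<^esub> x \<in> N"
  shows "ideal_mult M I \<subseteq> N"
proof -
  have sub: "subgroup N (add_monoid M)" using N by (rule submodule.axioms)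
  have "{r \<odot>\<^bsub>M\<^esub> x | r x. r \<in> I \<and> x \<in> carrier M} \<subseteq> N" using gen by blast
  then show ?thesis
    unfolding ideal_mult_def by (rule group.generate_subgroup_incl[OF M.a_group _ sub])
qed

lemma ideal_mult_carrier [simp]: "ideal_mult M (carrier R) = carrier M"
proof
  show "ideal_mult M (carrier R) \<subseteq> carrier M"
    using submoduleE(1)[OF submodule_ideal_mult[OF R.oneideal]] .
  show "carrier M \<subseteq> ideal_mult M (carrier R)"
  proof
    fix x assume x: "x \<in> carrier M"
    then have "\<one> \<odot>\<^bsub>M\<^esub> x \<in> ideal_mult M (carrier R)"
      unfolding ideal_mult_def by (intro generate.incl) blast
    then show "x \<in> ideal_mult M (carrier R)" using x by simp
  qed
qed

lemma zero_in_ideal_mult: "\<zero>\<^bsub>M\<^esub> \<in> ideal_mult M I"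
  unfolding ideal_mult_def using generate.one[of "add_monoid M"] by simp

lemma ideal_mult_zero: "ideal_mult M {\<zero>} = {\<zero>\<^bsub>M\<^esub>}"
proof
  have "submodule {\<zero>\<^bsub>M\<^esub>} R M" by (rule submoduleI) auto
  then show "ideal_mult M {\<zero>} \<subseteq> {\<zero>\<^bsub>M\<^esub>}" by (rule ideal_mult_least) auto
qed (use zero_in_ideal_mult in auto)

text \<open>Multiplication by \<open>j\<close> sends a generator \<open>r x\<close> of
  \<open>I M\<close> to \<open>(j r) x\<close> with \<open>j r \<in> I \<inter> J\<close>. The
  elements that \<open>j\<close> sends into the target form a submodule \<open>?N\<close>, so
  generators suffice.\<close>

lemma smult_ideal_mult_Int:
  assumes I: "ideal I R" and J: "ideal J R" and j: "j \<in> J" and f: "f \<in> ideal_mult M I"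
  shows "j \<odot>\<^bsub>M\<^esub> f \<in> ideal_mult M (I \<inter> J)"
proof -
  interpret I: ideal I R by fact
  interpret J: ideal J R by fact
  have jR: "j \<in> carrier R" using j by (rule J.Icarr)
  have IJ: "submodule (ideal_mult M (I \<inter> J)) R M"
    using R.i_intersect[OF I J] by (rule submodule_ideal_mult)
  let ?N = "{x \<in> carrier M. j \<odot>\<^bsub>M\<^esub> x \<in> ideal_mult M (I \<inter> J)}"
  have "submodule ?N R M"
  proof (rule submoduleI)
    show "\<zero>\<^bsub>M\<^esub> \<in> ?N" using zero_in_ideal_mult jR by simp
    show "\<ominus>\<^bsub>M\<^esub> a \<in> ?N" if "a \<in> ?N" for a
      using that submoduleE(3)[OF IJ] jR by (simp add: smult_r_minus)
    show "a \<oplus>\<^bsub>M\<^esub> b \<in> ?N" if "a \<in> ?N" "b \<in> ?N" for a b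
      using that submoduleE(5)[OF IJ] jR by (simp add: smult_r_distr)
    show "a \<odot>\<^bsub>M\<^esub> x \<in> ?N" if a: "a \<in> carrier R" and x: "x \<in> ?N" for a x
    proof -
      have "j \<odot>\<^bsub>M\<^esub> (a \<odot>\<^bsub>M\<^esub> x) = a \<odot>\<^bsub>M\<^esub> (j \<odot>\<^bsub>M\<^esub> x)"
        using a x jR smult_assoc1[of a j x] smult_assoc1[of j a x] R.m_comm[of a j] by simp
      then show ?thesis using a x submoduleE(4)[OF IJ a] by simp
    qed
  qed auto
  moreover have "r \<odot>\<^bsub>M\<^esub> x \<in> ?N" if r: "r \<in> I" and x: "x \<in> carrier M" for r x
  proof -
    have rR: "r \<in> carrier R" using r by (rule I.Icarr)
    have "j \<otimes> r \<in> I \<inter> J" using I.I_l_closed[OF r jR] J.I_r_closed[OF j rR] by simp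
    then have "(j \<otimes> r) \<odot>\<^bsub>M\<^esub> x \<in> ideal_mult M (I \<inter> J)"
      unfolding ideal_mult_def using x by (intro generate.incl) blast
    then show ?thesis using smult_assoc1[OF jR rR x] rR x by simp
  qed
  ultimately have "ideal_mult M I \<subseteq> ?N" by (rule ideal_mult_least)
  then show ?thesis using f by blast
qed

text \<open>With \<open>i \<oplus> j = \<one>\<close>, \<open>f\<close> is the sum of
  \<open>i f\<close> and \<open>j f\<close>. The first lies in the target because
  \<open>f \<in> J M\<close>, the second because \<open>f \<in> I M\<close>.\<close>

lemma comaximal_ideal_mult_Int:
  assumes I: "ideal I R" and J: "ideal J R" and co: "I <+> J = carrier R"
    and f: "f \<in> ideal_mult M I" "f \<in> ideal_mult M J"
  shows "f \<in> ideal_mult M (I \<inter> J)"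
proof -
  obtain i j where ij: "i \<in> I" "j \<in> J" "i \<oplus> j = \<one>"
    using co R.comaximal_iff[OF I J] by blast
  have fM: "f \<in> carrier M"
    using f(1) submoduleE(1)[OF submodule_ideal_mult[OF I]] by blast
  have "J \<inter> I = I \<inter> J" by blast
  then have "i \<odot>\<^bsub>M\<^esub> f \<in> ideal_mult M (I \<inter> J)"
    using smult_ideal_mult_Int[OF J I ij(1) f(2)] by argo
  moreover have "j \<odot>\<^bsub>M\<^esub> f \<in> ideal_mult M (I \<inter> J)"
    using I J ij(2) f(1) by (rule smult_ideal_mult_Int)
  ultimately have "i \<odot>\<^bsub>M\<^esub> f \<oplus>\<^bsub>M\<^esub> j \<odot>\<^bsub>M\<^esub> f \<in> ideal_mult M (I \<inter> J)"
    by (rule submoduleE(5)[OF submodule_ideal_mult[OF R.i_intersect[OF I J]]])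
  moreover have "i \<odot>\<^bsub>M\<^esub> f \<oplus>\<^bsub>M\<^esub> j \<odot>\<^bsub>M\<^esub> f = f"
    using smult_l_distr[OF ideal.Icarr[OF I ij(1)] ideal.Icarr[OF J ij(2)] fM] ij(3) fM by simp
  ultimately show ?thesis by simp
qed

lemma comaximal_ideal_mult_INT:
  assumes "finite F" "\<And>x. x \<in> F \<Longrightarrow> ideal (g x) R"
    and "\<And>x y. x \<in> F \<Longrightarrow> y \<in> F \<Longrightarrow> x \<noteq> y \<Longrightarrow> g x <+> g y = carrier R"
    and "f \<in> carrier M" "\<And>x. x \<in> F \<Longrightarrow> f \<in> ideal_mult M (g x)"
  shows "f \<in> ideal_mult M (carrier R \<inter> (\<Inter>x\<in>F. g x))"
  using assms
proof (induction F)
  case empty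
  then show ?case by simp
next
  case (insert x F)
  have K: "ideal (carrier R \<inter> (\<Inter>x\<in>F. g x)) R"
    by (rule R.ideal_Int_INT) (use insert in auto)
  have gx: "ideal (g x) R" using insert by simp
  have "g x <+> g y = carrier R" if "y \<in> F" for y
    using insert.prems(2)[of x y] insert.hyps(2) that by blast
  then have "g x <+> (carrier R \<inter> (\<Inter>x\<in>F. g x)) = carrier R"
    by (intro R.comaximal_INT insert.hyps gx) (use insert.prems(1) in auto)
  moreover have "f \<in> ideal_mult M (carrier R \<inter> (\<Inter>x\<in>F. g x))"
    by (rule insert.IH) (use insert.prems in auto)
  moreover have "f \<in> ideal_mult M (g x)" using insert.prems by simp
  ultimately have "f \<in> ideal_mult M (g x \<inter> (carrier R \<inter> (\<Inter>x\<in>F. g x)))"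
    using comaximal_ideal_mult_Int[OF gx K] by blast
  moreover have "g x \<inter> (carrier R \<inter> (\<Inter>x\<in>F. g x)) = carrier R \<inter> (\<Inter>x\<in>insert x F. g x)"
    by auto
  ultimately show ?case by simp
qed

text \<open>The unit ideal belongs to \<open>content_ideals R M f\<close>, so the intersection runs
  over a nonempty family of ideals.\<close>

lemma ideal_ohm_rush_content:
  assumes "f \<in> carrier M"
  shows "ideal (ohm_rush_content R M f) R"
  unfolding ohm_rush_content_def
  by (rule R.i_Intersect) (use assms R.oneideal in \<open>auto simp: content_ideals_def\<close>)

end

section \<open>The two implications of the criterion\<close>

lemma (in dedekind_domain) mem_content_imp_finite_bounded:
  assumes "module R M" and f: "f \<in> carrier M" "f \<noteq> \<zero>\<^bsub>M\<^esub>"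
    and mem: "f \<in> ideal_mult M (ohm_rush_content R M f)"
  shows "finite (content_ideals R M f \<inter> Spec R)"
    and "\<exists>n. \<forall>P \<in> Spec R. f \<notin> ideal_mult M (ideal_power R P n)"
proof -
  interpret M: module R M by fact
  let ?c = "ohm_rush_content R M f"
  have c: "ideal ?c R" using f(1) by (rule M.ideal_ohm_rush_content)
  \<comment> \<open>The zero ideal times \<open>M\<close> is zero and cannot contain
    \<open>f\<close>.\<close>
  have c_nz: "?c \<noteq> {\<zero>}" using mem f(2) M.ideal_mult_zero by auto
  have c_sub: "?c \<subseteq> I" if "ideal I R" "f \<in> ideal_mult M I" for I
    using that by (auto simp: ohm_rush_content_def content_ideals_def)
  define T where "T = {P. primeideal P R \<and> ?c \<subseteq> P}"
  have fin: "finite T" unfolding T_def using c c_nz by (rule finite_primes_containing)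
  moreover have "content_ideals R M f \<inter> Spec R \<subseteq> T"
    using c_sub by (auto simp: content_ideals_def Spec_def T_def)
  ultimately show "finite (content_ideals R M f \<inter> Spec R)" by (rule finite_subset[rotated])
  have nz: "P \<noteq> {\<zero>}" if "P \<in> T" for P
    using that c_nz additive_subgroup.zero_closed[OF ideal.axioms(1)[OF c]] by (auto simp: T_def)
  have "\<exists>n. \<not> ?c \<subseteq> ideal_power R P n" if "P \<in> T" for P
    using not_subset_prime_power[OF c c_nz _ nz[OF that]] that by (simp add: T_def)
  then obtain e where e: "\<And>P. P \<in> T \<Longrightarrow> \<not> ?c \<subseteq> ideal_power R P (e P)" by metis
  \<comment> \<open>The sum dominates each \<open>e P\<close>, which gives one exponent for all
    primes in \<open>T\<close>. The \<open>Suc\<close> ensures \<open>n > 0\<close>, so that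
    \<open>P ^ n \<subseteq> P\<close> and any prime with \<open>f \<in> P ^ n M\<close> belongs to
    \<open>T\<close>.\<close>
  define n where "n = Suc (\<Sum>P\<in>T. e P)"
  have "f \<notin> ideal_mult M (ideal_power R P n)" if P: "P \<in> Spec R" for P
  proof
    assume fP: "f \<in> ideal_mult M (ideal_power R P n)"
    have prime: "primeideal P R" using P by (simp add: Spec_def)
    have P': "ideal P R" using prime by (rule primeideal.axioms)
    have sub: "?c \<subseteq> ideal_power R P n" using ideal_ideal_power[OF P'] fP by (rule c_sub)
    also have "\<dots> \<subseteq> P" using P' by (rule ideal_power_subset) (simp add: n_def)
    finally have "P \<in> T" using prime by (simp add: T_def)
    moreover from this have "e P \<le> n" using member_le_sum[of P T e] fin by (simp add: n_def)
    then have "?c \<subseteq> ideal_power R P (e P)" using sub ideal_power_antimono[OF P'] by blast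
    ultimately show False using e by blast
  qed
  then show "\<exists>n. \<forall>P \<in> Spec R. f \<notin> ideal_mult M (ideal_power R P n)" by blast
qed

text \<open>It suffices to find an ideal \<open>I\<close> with \<open>f \<in> I M\<close> that lies
  in every member of \<open>content_ideals R M f\<close>: then \<open>I\<close> lies in the content,
  and \<open>I M\<close> in its multiple of \<open>M\<close>.\<close>

lemma (in dedekind_domain) finite_bounded_imp_mem_content:
  assumes "module R M" and f: "f \<in> carrier M" "f \<noteq> \<zero>\<^bsub>M\<^esub>"
    and fin: "finite (content_ideals R M f \<inter> Spec R)"
    and bounded: "\<forall>P \<in> Spec R. f \<notin> ideal_mult M (ideal_power R P n)"
  shows "f \<in> ideal_mult M (ohm_rush_content R M f)"
proof -
  interpret M: module R M by fact
  define T where "T = content_ideals R M f \<inter> Spec R"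
  \<comment> \<open>The greatest exponent exists: \<open>k = 0\<close> qualifies since
    \<open>P ^ 0 M = M\<close>, and \<open>bound\<close> below caps \<open>k\<close> by
    \<open>n\<close>.\<close>
  define e where "e P = (GREATEST k. f \<in> ideal_mult M (ideal_power R P k))" for P
  define I where "I = carrier R \<inter> (\<Inter>P\<in>T. ideal_power R P (e P))"
  have nz: "J \<noteq> {\<zero>}" if "J \<in> content_ideals R M f" for J
    using that f(2) M.ideal_mult_zero by (auto simp: content_ideals_def)
  have T: "primeideal P R" "P \<noteq> {\<zero>}" "ideal P R" if "P \<in> T" for P
    using that nz by (auto simp: T_def Spec_def content_ideals_def)
  have bound: "k \<le> n" if P: "primeideal P R" and k: "f \<in> ideal_mult M (ideal_power R P k)" for P k
  proof (rule ccontr)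
    assume "\<not> k \<le> n"
    then have "ideal_power R P k \<subseteq> ideal_power R P n"
      by (intro ideal_power_antimono primeideal.axioms(1)[OF P]) simp
    then have "f \<in> ideal_mult M (ideal_power R P n)" using k M.ideal_mult_mono by blast
    then show False using bounded P by (simp add: Spec_def)
  qed
  have e: "f \<in> ideal_mult M (ideal_power R P (e P))"
    "\<And>k. f \<in> ideal_mult M (ideal_power R P k) \<Longrightarrow> k \<le> e P" if "P \<in> T" for P
  proof -
    let ?Q = "\<lambda>k. f \<in> ideal_mult M (ideal_power R P k)"
    have "?Q 0" using f(1) by simp
    then show "?Q (e P)"
      unfolding e_def by (rule GreatestI_nat[of ?Q]) (rule bound[OF T(1)[OF that]])
    show "k \<le> e P" if k: "?Q k" for k
      unfolding e_def using k
      by (rule Greatest_le_nat[of ?Q]) (rule bound[OF T(1)[OF \<open>P \<in> T\<close>]])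
  qed
  have I: "ideal I R"
    unfolding I_def by (rule ideal_Int_INT) (intro ideal_ideal_power T)
  have "f \<in> ideal_mult M I"
    unfolding I_def
  proof (rule M.comaximal_ideal_mult_INT)
    show "finite T" using fin by (simp add: T_def)
    show "ideal_power R P (e P) <+> ideal_power R Q (e Q) = carrier R"
      if "P \<in> T" "Q \<in> T" "P \<noteq> Q" for P Q
      using comaximal_primes[of P Q] T[OF that(1)] T[OF that(2)] that(3)
      by (intro comaximal_powers) auto
  qed (use T ideal_ideal_power f(1) e(1) in auto)
  \<comment> \<open>Only prime powers containing \<open>J\<close> need to be checked. If
    \<open>J \<subseteq> P ^ m\<close> with \<open>m > 0\<close>, then
    \<open>f \<in> P ^ m M \<subseteq> P M\<close>, so \<open>P \<in> T\<close> and
    \<open>m \<le> e P\<close>.\<close>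
  moreover have "I \<subseteq> J" if J: "J \<in> content_ideals R M f" for J
  proof (rule subset_if_prime_powers)
    show "ideal J R" "J \<noteq> {\<zero>}" "ideal I R"
      using J nz I by (auto simp: content_ideals_def)
    fix P m assume P: "primeideal P R" "P \<noteq> {\<zero>}" and sub: "J \<subseteq> ideal_power R P m"
    have P': "ideal P R" using P(1) by (rule primeideal.axioms)
    show "I \<subseteq> ideal_power R P m"
    proof (cases "m = 0")
      case True
      then show ?thesis by (auto simp: I_def)
    next
      case False
      have fm: "f \<in> ideal_mult M (ideal_power R P m)"
        using J M.ideal_mult_mono[OF sub] by (auto simp: content_ideals_def)
      then have "f \<in> ideal_mult M P"
        using M.ideal_mult_mono[OF ideal_power_subset[OF P', of m]] False by blast
      then have PT: "P \<in> T" using P P' by (simp add: T_def Spec_def content_ideals_def)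
      have "I \<subseteq> ideal_power R P (e P)" using PT by (auto simp: I_def)
      also have "\<dots> \<subseteq> ideal_power R P m"
        using P' e(2)[OF PT fm] by (rule ideal_power_antimono)
      finally show ?thesis .
    qed
  qed
  then have "I \<subseteq> ohm_rush_content R M f" by (auto simp: ohm_rush_content_def)
  ultimately show ?thesis using M.ideal_mult_mono by blast
qed

theorem theorem3p3:
  fixes R :: "('a, 'm) ring_scheme" and M :: "('a, 'b, 'n) module_scheme"
  assumes "dedekind_domain R"
    and "module R M"
    and "flat_module R M \<or> torsion_free_module R M"
  shows "(\<forall>f \<in> carrier M - {\<zero>\<^bsub>M\<^esub>}.
            f \<in> ideal_mult M (ohm_rush_content R M f) \<longleftrightarrow>
              finite (content_ideals R M f \<inter> Spec R) \<and>
              (\<exists>n. \<forall>P \<in> Spec R. f \<notin> ideal_mult M (ideal_power R P n))) \<and>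
         (ohm_rush R M \<longleftrightarrow>
            (\<forall>f \<in> carrier M - {\<zero>\<^bsub>M\<^esub>}.
              finite (content_ideals R M f \<inter> Spec R) \<and>
              (\<exists>n. \<forall>P \<in> Spec R. f \<notin> ideal_mult M (ideal_power R P n))))"
proof -
  interpret dedekind_domain R by fact
  interpret M: module R M by fact
  have main: "f \<in> ideal_mult M (ohm_rush_content R M f) \<longleftrightarrow>
      finite (content_ideals R M f \<inter> Spec R) \<and>
      (\<exists>n. \<forall>P \<in> Spec R. f \<notin> ideal_mult M (ideal_power R P n))"
    if "f \<in> carrier M - {\<zero>\<^bsub>M\<^esub>}" for f
  proof -
    have f: "f \<in> carrier M" "f \<noteq> \<zero>\<^bsub>M\<^esub>" using that by auto
    show ?thesis
      using mem_content_imp_finite_bounded[OF assms(2) f]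
        finite_bounded_imp_mem_content[OF assms(2) f] by blast
  qed
  \<comment> \<open>The zero element lies in every \<open>ideal_mult M I\<close>, so only nonzero
    \<open>f\<close> impose a condition.\<close>
  have "ohm_rush R M \<longleftrightarrow>
      (\<forall>f \<in> carrier M - {\<zero>\<^bsub>M\<^esub>}. f \<in> ideal_mult M (ohm_rush_content R M f))"
    unfolding ohm_rush_def using M.zero_in_ideal_mult by blast
  then show ?thesis using main by simp
qed

end
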